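(* Let $X$ be a Cantor set and $S:X\to X$ an aperiodic homeomorphism such that $(X,S)$ has finite topological rank $K$. If the restriction of $(X,S)$ to every minimal component is not homeomorphic to an odometer, then $(X,S)$ is expansive.
   Context: A Cantor set is a zero-dimensional compact metric space without isolated points. A homeomorphism $S:X\to X$ is aperiodic if every $S$-orbit is infinite. A minimal component of $(X,S)$ is a nonempty closed $S$-invariant set $Z\subseteq X$ on which every $S$-orbit is dense in $Z$. Two systems $(X,S)$ and $(Y,T)$ are called homeomorphic (conjugate) if there is a homeomorphism $h:X\to Y$ with $h\circ S=T\circ h$. An odometer is the translation by $1$ on an inverse limit of cyclic groups $\varprojlim \mathbb Z/n_k\mathbb Z$ with $n_k\mid n_{k+1}$ and $n_k\to\infty$. A homeomorphism $S$ of a compact metric space $(X,d)$ is expansive if there is $\delta>0$ such that for any distinct $x,y\in X$ there is $m\in\mathbb Z$ with $d(S^mx,S^my)>\delta$ (this does not depend on the metric $d$ generating the topology). A Bratteli diagram is an infinite graph $B=(V,E)$ whose vertex set $V=\bigcup_{i\ge 0}V_i$ and edge set $E=\bigcup_{i\ge 1}E_i$ are partitioned into disjoint finite sets $V_i$, $E_i$, with $V_0=\{v_0\}$ a single point, together with a range map $r$ and a source map $s$ from $E$ to $V$ such that $r(E_i)=V_i$, $s(E_i)=V_{i-1}$, $s^{-1}(v)\ne\emptyset$ for all $v\in V$ and $r^{-1}(v')\neq\emptyset$ for all $v'\in V\setminus V_0$. $X_B$ is the set of infinite paths $x=(x_1,x_2,\dots)$, $x_i\in E_i$, $r(x_i)=s(x_{i+1})$,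 with the topology generated by the cylinder sets $\{x: x_1=e_1,\dots,x_n=e_n\}$. For $v\in V$, $E(v_0,v)$ is the set of finite paths from $v_0$ to $v$. An ordered Bratteli diagram $B=(V,E,\le)$ is a Bratteli diagram with a partial order on each $E_i$ such that $e,e'$ are comparable if and only if $r(e)=r(e')$. A (finite or infinite) path is maximal (minimal) if each of its edges $e$ is maximal (minimal) in $r^{-1}(r(e))$; $X_{\max}$, $X_{\min}$ are the sets of maximal and minimal infinite paths. A Vershik homeomorphism (map) is a homeomorphism $\varphi_B:X_B\to X_B$ such that $\varphi_B(X_{\max})=X_{\min}$ and, for $x=(x_1,x_2,\dots)\notin X_{\max}$, $\varphi_B(x)=(x_1^0,\dots,x_{k-1}^0,\overline{x_k},x_{k+1},x_{k+2},\dots)$, where $k=\min\{n\ge1: x_n \text{ is not maximal}\}$, $\overline{x_k}$ is the successor of $x_k$ in $r^{-1}(r(x_k))$, and $(x_1^0,\dots,x_{k-1}^0)$ is the minimal path in $E(v_0,s(\overline{x_k}))$. The pair $(X_B,\varphi_B)$ is then a Bratteli-Vershik system. A Cantor dynamical system $(X,S)$ has topological rank $K>0$ if it is conjugate to a Bratteli-Vershik system $(X_B,\varphi_B)$ such that the number of vertices of $B$ at each level is not greater than $K$, and $K$ is the least such number over all Bratteli-Vershik realizations of $(X,S)$. *)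

theory Defs
  imports "HOL-Analysis.Analysis"
begin

subsection \<open>Topological dynamical systems\<close>

text \<open>Spaces are carried by a topology or a metric on a subset of a type, so a transformation
  \<open>S\<close> is a function on the type of which only the values on the carrier matter.\<close>

definition cantor_set :: "'a metric \<Rightarrow> bool" where
  "cantor_set X \<longleftrightarrow>
     compact_space (mtopology_of X) \<and>
     mtopology_of X dim_le 0 \<and>
     (\<forall>x\<in>mspace X. \<not> openin (mtopology_of X) {x})"

definition int_iterate :: "'a set \<Rightarrow> ('a \<Rightarrow> 'a) \<Rightarrow> int \<Rightarrow> 'a \<Rightarrow> 'a" where
  "int_iterate A S m =
     (if 0 \<le> m then S ^^ nat m else (inv_into A S) ^^ nat (- m))"

definition int_orbit :: "'a set \<Rightarrow> ('a \<Rightarrow> 'a) \<Rightarrow> 'a \<Rightarrow> 'a set" where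
  "int_orbit A S x = range (\<lambda>m. int_iterate A S m x)"

definition aperiodic :: "'a topology \<Rightarrow> ('a \<Rightarrow> 'a) \<Rightarrow> bool" where
  "aperiodic X S \<longleftrightarrow> (\<forall>x\<in>topspace X. infinite (int_orbit (topspace X) S x))"

definition minimal_component :: "'a topology \<Rightarrow> ('a \<Rightarrow> 'a) \<Rightarrow> 'a set \<Rightarrow> bool" where
  "minimal_component X S Z \<longleftrightarrow>
     Z \<noteq> {} \<and> closedin X Z \<and> S ` Z = Z \<and>
     (\<forall>z\<in>Z. X closure_of (int_orbit (topspace X) S z) = Z)"

definition conjugate_systems ::
    "'a topology \<Rightarrow> ('a \<Rightarrow> 'a) \<Rightarrow> 'b topology \<Rightarrow> ('b \<Rightarrow> 'b) \<Rightarrow> bool" where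
  "conjugate_systems X S Y T \<longleftrightarrow>
     (\<exists>h. homeomorphic_map X Y h \<and> (\<forall>x\<in>topspace X. h (S x) = T (h x)))"

definition expansive :: "'a metric \<Rightarrow> ('a \<Rightarrow> 'a) \<Rightarrow> bool" where
  "expansive X S \<longleftrightarrow>
     (\<exists>\<delta>>0. \<forall>x\<in>mspace X. \<forall>y\<in>mspace X. x \<noteq> y \<longrightarrow>
        (\<exists>m. mdist X (int_iterate (mspace X) S m x) (int_iterate (mspace X) S m y) > \<delta>))"

subsection \<open>Odometers\<close>

text \<open>The cyclic group of order \<open>n k\<close> is represented by the residues \<open>{..<n k}\<close> with addition
  modulo \<open>n k\<close>; the bonding maps of the inverse system are reduction modulo \<open>n k\<close>.\<close>

definition odometer_topology :: "(nat \<Rightarrow> nat) \<Rightarrow> (nat \<Rightarrow> nat) topology" where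
  "odometer_topology n =
     subtopology (product_topology (\<lambda>k. discrete_topology {..<n k}) UNIV)
       {x. \<forall>k. x (Suc k) mod n k = x k}"

definition odometer_map :: "(nat \<Rightarrow> nat) \<Rightarrow> (nat \<Rightarrow> nat) \<Rightarrow> (nat \<Rightarrow> nat)" where
  "odometer_map n x = (\<lambda>k. (x k + 1) mod n k)"

definition conjugate_to_odometer :: "'a topology \<Rightarrow> ('a \<Rightarrow> 'a) \<Rightarrow> bool" where
  "conjugate_to_odometer X S \<longleftrightarrow>
     (\<exists>n. (\<forall>k. 0 < n k) \<and> (\<forall>k. n k dvd n (Suc k)) \<and> filterlim n at_top sequentially \<and>
          conjugate_systems X S (odometer_topology n) (odometer_map n))"

subsection \<open>Ordered Bratteli diagrams\<close>

text \<open>Edge levels are numbered from \<open>0\<close>: \<open>edges B i\<close> is the set of edges from level \<open>i\<close> to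
  level \<open>Suc i\<close>, usually written \<open>E\<close> with index \<open>i + 1\<close>. Accordingly the entry \<open>x i\<close> of an
  infinite path is its \<open>(i + 1)\<close>-st edge. \<open>edge_order B i\<close> is the (reflexive) order on
  \<open>edges B i\<close>.\<close>

record ('v, 'e) bratteli =
  verts :: "nat \<Rightarrow> 'v set"
  edges :: "nat \<Rightarrow> 'e set"
  src :: "'e \<Rightarrow> 'v"
  rng :: "'e \<Rightarrow> 'v"
  edge_order :: "nat \<Rightarrow> ('e \<times> 'e) set"

text \<open>The conditions on the images of \<open>src\<close> and \<open>rng\<close> subsume the requirements that every
  vertex emits an edge and every vertex not in \<open>verts B 0\<close> receives one.\<close>

definition bratteli_diagram :: "('v, 'e) bratteli \<Rightarrow> bool" where
  "bratteli_diagram B \<longleftrightarrow>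
     (\<forall>i. finite (verts B i)) \<and> disjoint_family (verts B) \<and>
     (\<forall>i. finite (edges B i)) \<and> disjoint_family (edges B) \<and>
     (\<exists>v0. verts B 0 = {v0}) \<and>
     (\<forall>i. src B ` edges B i = verts B i) \<and>
     (\<forall>i. rng B ` edges B i = verts B (Suc i))"

definition ordered_bratteli_diagram :: "('v, 'e) bratteli \<Rightarrow> bool" where
  "ordered_bratteli_diagram B \<longleftrightarrow>
     bratteli_diagram B \<and>
     (\<forall>i. partial_order_on (edges B i) (edge_order B i) \<and>
          (\<forall>e\<in>edges B i. \<forall>f\<in>edges B i.
             ((e, f) \<in> edge_order B i \<or> (f, e) \<in> edge_order B i) \<longleftrightarrow> rng B e = rng B f))"

definition paths :: "('v, 'e) bratteli \<Rightarrow> (nat \<Rightarrow> 'e) set" where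
  "paths B = {x. \<forall>i. x i \<in> edges B i \<and> rng B (x i) = src B (x (Suc i))}"

definition path_topology :: "('v, 'e) bratteli \<Rightarrow> (nat \<Rightarrow> 'e) topology" where
  "path_topology B = topology_generated_by {{x \<in> paths B. \<forall>i<n. x i = e i} | n e. True}"

lemma topspace_path_topology: "topspace (path_topology B) = paths B"
  unfolding path_topology_def topology_generated_by_topspace
  by (auto intro: exI[of _ "{x \<in> paths B. \<forall>i<0. x i = e i}" for e])

definition maximal_edge :: "('v, 'e) bratteli \<Rightarrow> nat \<Rightarrow> 'e \<Rightarrow> bool" where
  "maximal_edge B i e \<longleftrightarrow>
     e \<in> edges B i \<and>
     (\<forall>f\<in>edges B i. rng B f = rng B e \<and> (e, f) \<in> edge_order B i \<longrightarrow> f = e)"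

definition minimal_edge :: "('v, 'e) bratteli \<Rightarrow> nat \<Rightarrow> 'e \<Rightarrow> bool" where
  "minimal_edge B i e \<longleftrightarrow>
     e \<in> edges B i \<and>
     (\<forall>f\<in>edges B i. rng B f = rng B e \<and> (f, e) \<in> edge_order B i \<longrightarrow> f = e)"

definition successor_edge :: "('v, 'e) bratteli \<Rightarrow> nat \<Rightarrow> 'e \<Rightarrow> 'e \<Rightarrow> bool" where
  "successor_edge B i e f \<longleftrightarrow>
     f \<in> edges B i \<and> rng B f = rng B e \<and> (e, f) \<in> edge_order B i \<and> f \<noteq> e \<and>
     (\<forall>g\<in>edges B i. rng B g = rng B e \<and> (e, g) \<in> edge_order B i \<and> g \<noteq> e \<longrightarrow>
        (f, g) \<in> edge_order B i)"

definition maximal_paths :: "('v, 'e) bratteli \<Rightarrow> (nat \<Rightarrow> 'e) set" where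
  "maximal_paths B = {x \<in> paths B. \<forall>i. maximal_edge B i (x i)}"

definition minimal_paths :: "('v, 'e) bratteli \<Rightarrow> (nat \<Rightarrow> 'e) set" where
  "minimal_paths B = {x \<in> paths B. \<forall>i. minimal_edge B i (x i)}"

text \<open>In \<open>vershik_successor\<close>, membership of \<open>y\<close> in \<open>paths B\<close> makes its first \<open>k\<close> edges a path
  from the top vertex to the source of \<open>y k\<close>; being composed of minimal edges, it is the minimal
  path between these vertices.\<close>

definition vershik_successor :: "('v, 'e) bratteli \<Rightarrow> (nat \<Rightarrow> 'e) \<Rightarrow> (nat \<Rightarrow> 'e) \<Rightarrow> bool" where
  "vershik_successor B x y \<longleftrightarrow>
     (let k = (LEAST i. \<not> maximal_edge B i (x i)) in
        y \<in> paths B \<and> (\<forall>i<k. minimal_edge B i (y i)) \<and>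
        successor_edge B k (x k) (y k) \<and> (\<forall>i>k. y i = x i))"

definition vershik_map :: "('v, 'e) bratteli \<Rightarrow> ((nat \<Rightarrow> 'e) \<Rightarrow> (nat \<Rightarrow> 'e)) \<Rightarrow> bool" where
  "vershik_map B \<phi> \<longleftrightarrow>
     homeomorphic_map (path_topology B) (path_topology B) \<phi> \<and>
     \<phi> ` maximal_paths B = minimal_paths B \<and>
     (\<forall>x \<in> paths B - maximal_paths B. vershik_successor B x (\<phi> x))"

subsection \<open>Topological rank\<close>

text \<open>The vertices and edges of a Bratteli diagram form countable sets, so letting them be natural
  numbers covers all diagrams up to isomorphism.\<close>

definition bratteli_vershik_realization ::
    "'a topology \<Rightarrow> ('a \<Rightarrow> 'a) \<Rightarrow> (nat, nat) bratteli \<Rightarrow> ((nat \<Rightarrow> nat) \<Rightarrow> (nat \<Rightarrow> nat)) \<Rightarrow> bool" where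
  "bratteli_vershik_realization X S B \<phi> \<longleftrightarrow>
     ordered_bratteli_diagram B \<and> vershik_map B \<phi> \<and> conjugate_systems X S (path_topology B) \<phi>"

definition realizable_with_width :: "'a topology \<Rightarrow> ('a \<Rightarrow> 'a) \<Rightarrow> nat \<Rightarrow> bool" where
  "realizable_with_width X S K \<longleftrightarrow>
     (\<exists>B \<phi>. bratteli_vershik_realization X S B \<phi> \<and> (\<forall>i. card (verts B i) \<le> K))"

definition has_topological_rank :: "'a topology \<Rightarrow> ('a \<Rightarrow> 'a) \<Rightarrow> nat \<Rightarrow> bool" where
  "has_topological_rank X S K \<longleftrightarrow>
     0 < K \<and> realizable_with_width X S K \<and> (\<forall>K'. realizable_with_width X S K' \<longrightarrow> K \<le> K')"

end

theory Submission
  imports Defs "HOL-Library.Stream"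
begin

text \<open>
  An ordered Bratteli diagram of width \<open>K\<close> cuts the space into towers, at most \<open>K\<close> of them at each
  level, and every tower of level \<open>l\<close> is a stack of towers of a lower level \<open>k\<close>. The orbit of a point
  thereby has a name at each level, namely the bi-infinite sequence of the floors that it visits, and
  points are separated by their floors at all levels together. By compactness, \<open>S\<close> is expansive as
  soon as the names of one single level separate points (\<open>locally_constant_imp_uniformly\<close>). So
  suppose that at each level \<open>k\<close> there are two points with the same name.

  Two such points have different names at some level \<open>l > k\<close>. This means that one bi-infinite word
  over the towers of level \<open>k\<close> is factorized in two ways into the words \<open>\<sigma> v\<close> that describe the towers
  \<open>v\<close> of level \<open>l\<close>. By a defect theorem for bi-infinite words (\<open>defect_or_periodic\<close>), either the word
  is periodic, or all words \<open>\<sigma> v\<close> are products of fewer words than there are towers \<open>v\<close>. In the second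
  case the fewer words are the towers of a partition between the levels \<open>k\<close> and \<open>l\<close>
  (\<open>intermediate_of_defect\<close>). If this happened for arbitrarily large \<open>k\<close>, the partitions in between
  would form another presentation of the system, of smaller width. Hence it does not happen in a
  presentation of least width from some level on (\<open>rigid_scheme_exists\<close>), and there, at each level, some
  point has a periodic name (\<open>periodic_of_indistinct\<close>).

  The periods that occur at a fixed level are bounded (\<open>uniform_period\<close>): every infinite orbit passes
  through arbitrarily tall towers of high levels (\<open>tall_towers\<close>), so that among \<open>K + 1\<close> points with
  periodic names of that level two pass through the same tower which is taller than a common period,
  and their names agree up to a shift. Therefore the points with a periodic name of level \<open>k\<close> form a
  closed set. These sets decrease with \<open>k\<close>, so by compactness some point has a periodic name at
  every level (\<open>all_names_periodic\<close>). The closure of its orbit is a minimal component, and the phases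
  in the periodic names identify it with an odometer (\<open>odometer_component\<close>), which is excluded.
\<close>

section \<open>Morphisms on right-infinite words\<close>

abbreviation morph :: "('a \<Rightarrow> 'b list) \<Rightarrow> 'a stream \<Rightarrow> 'b stream" where
  "morph \<sigma> s \<equiv> flat (smap \<sigma> s)"

lemma set_stake_subset: "set (stake n s) \<subseteq> sset s"
  by (metis Un_upper1 sset_shift stake_sdrop)

lemma sset_sdrop_subset: "sset (sdrop n s) \<subseteq> sset s"
  by (metis Un_upper2 sset_shift stake_sdrop)

lemma morph_shift:
  assumes "\<And>a. a \<in> set w \<Longrightarrow> \<sigma> a \<noteq> []"
  shows "morph \<sigma> (w @- s) = concat (map \<sigma> w) @- morph \<sigma> s"
  using assms by (induction w) auto

lemma sset_morph:
  assumes "\<And>a. a \<in> sset s \<Longrightarrow> \<sigma> a \<noteq> []"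
  shows "sset (morph \<sigma> s) = (\<Union>a\<in>sset s. set (\<sigma> a))"
  using assms sset_flat[of "smap \<sigma> s"] by (auto simp: stream.set_map)

lemma stream_eq_growing_prefixes:
  assumes "\<And>n. \<exists>w u v. n \<le> length w \<and> s = w @- u \<and> t = w @- v"
  shows "s = t"
proof -
  have "snth s n = snth t n" for n
  proof -
    obtain w u v where "Suc n \<le> length w" "s = w @- u" "t = w @- v"
      using assms[of "Suc n"] by blast
    then show ?thesis by (simp add: shift_snth_less)
  qed
  then show ?thesis by (metis smap_alt stream.map_id)
qed

lemma morph_morph:
  assumes "\<And>a. a \<in> sset s \<Longrightarrow> \<rho> a \<noteq> []"
    and "\<And>a b. a \<in> sset s \<Longrightarrow> b \<in> set (\<rho> a) \<Longrightarrow> \<sigma> b \<noteq> []"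
  shows "morph \<sigma> (morph \<rho> s) = morph (\<lambda>a. concat (map \<sigma> (\<rho> a))) s"
proof (rule stream_eq_growing_prefixes)
  fix n
  let ?\<kappa> = "\<lambda>a. concat (map \<sigma> (\<rho> a))"
  note sub = set_stake_subset[of _ s]
  have ne: "?\<kappa> a \<noteq> []" if "a \<in> sset s" for a
    using assms that by (metis concat_eq_Nil_conv imageI last_in_set list.set_map)
  have 1: "morph ?\<kappa> s = concat (map ?\<kappa> (stake n s)) @- morph ?\<kappa> (sdrop n s)"
    using morph_shift[of "stake n s" ?\<kappa> "sdrop n s"] ne sub[of n] unfolding stake_sdrop by blast
  have "morph \<rho> s = concat (map \<rho> (stake n s)) @- morph \<rho> (sdrop n s)"
    using morph_shift[of "stake n s" \<rho> "sdrop n s"] assms(1) sub[of n] unfolding stake_sdrop by blast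
  moreover have "\<sigma> b \<noteq> []" if "b \<in> set (concat (map \<rho> (stake n s)))" for b
    using that assms(2) sub[of n] by auto
  ultimately have 2: "morph \<sigma> (morph \<rho> s) =
      concat (map \<sigma> (concat (map \<rho> (stake n s)))) @- morph \<sigma> (morph \<rho> (sdrop n s))"
    by (metis morph_shift)
  have 3: "concat (map \<sigma> (concat (map \<rho> w))) = concat (map ?\<kappa> w)" for w
    by (induction w) auto
  have 4: "length w \<le> length (concat (map ?\<kappa> w))" if "set w \<subseteq> sset s" for w
    using that
  proof (induction w)
    case (Cons a w)
    then have "0 < length (?\<kappa> a)" using ne[of a] by (metis length_greater_0_conv list.set_intros(1) subsetD)
    moreover have "length w \<le> length (concat (map ?\<kappa> w))" using Cons by simp
    moreover have "length (concat (map ?\<kappa> (a # w))) = length (?\<kappa> a) + length (concat (map ?\<kappa> w))"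
      by simp
    ultimately show ?case by (simp only: list.size)
  qed simp
  from 4[OF sub[of n]] have "n \<le> length (concat (map ?\<kappa> (stake n s)))" by simp
  with 1 2 3 show "\<exists>w u v. n \<le> length w \<and> morph \<sigma> (morph \<rho> s) = w @- u \<and> morph ?\<kappa> s = w @- v"
    by metis
qed

lemma morph_cong:
  assumes "\<And>a. a \<in> sset s \<Longrightarrow> \<sigma> a = \<sigma>' a"
  shows "morph \<sigma> s = morph \<sigma>' s"
  using assms by (metis stream.map_cong)

lemma shift_eq_shift_cases:
  assumes "u @- s = v @- t"
  obtains r where "u = v @ r" "t = r @- s" | r where "v = u @ r" "s = r @- t"
  using assms
proof (induction u arbitrary: v thesis)
  case Nil then show ?case by auto
next
  case (Cons a u)
  show ?case
  proof (cases v)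
    case Nil then show ?thesis using Cons.prems(1)[of "a # u"] Cons.prems(3) by simp
  next
    case (Cons b v')
    then have "a = b" "u @- s = v' @- t" using Cons.prems by auto
    then show ?thesis using Cons Cons.IH[of v'] Cons.prems by auto
  qed
qed

text \<open>Two right-infinite words with the same image whose first letters \<open>c\<close> and \<open>d\<close> differ: one of \<open>\<sigma> c\<close> and
  \<open>\<sigma> d\<close> is a prefix of the other. If they are equal, the two letters are merged. Otherwise the longer
  one is replaced by its remainder, which shortens the words \<open>\<sigma> a\<close> in total, and cancelling the shorter
  one leaves again two words that begin with different letters. At each stage one letter, at the start
  \<open>d\<close>, is pending, and all others are first letters of images of \<open>A\<close>. The process can only end by
  merging the pending letter with another one. So the first letters of the images of \<open>A - {d}\<close> are
  all letters that remain; in particular there are at most \<open>card A - 1\<close> of them.\<close>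

lemma morphism_through_first_letters:
  fixes \<sigma> :: "'a \<Rightarrow> 'b list"
  assumes "finite A" and "\<And>a. a \<in> A \<Longrightarrow> \<sigma> a \<noteq> []"
    and "c \<in> A" "d \<in> A" "c \<noteq> d" "sset x \<subseteq> A" "sset y \<subseteq> A"
    and "morph \<sigma> (c ## x) = morph \<sigma> (d ## y)"
  shows "\<exists>(\<tau> :: 'a \<Rightarrow> 'a list) \<alpha>.
    (\<forall>a\<in>A. \<tau> a \<noteq> [] \<and> \<sigma> a = concat (map \<alpha> (\<tau> a)) \<and> set (\<tau> a) \<subseteq> (\<lambda>b. hd (\<tau> b)) ` (A - {d})) \<and>
    (\<forall>b \<in> (\<lambda>b. hd (\<tau> b)) ` (A - {d}). \<alpha> b \<noteq> [])"
  using assms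
proof (induction "\<Sum>a\<in>A. length (\<sigma> a)" arbitrary: \<sigma> c d x y rule: less_induct)
  case less
  note ne = less.prems(2) and cA = less.prems(3) and dA = less.prems(4) and cd = less.prems(5)
    and xA = less.prems(6) and yA = less.prems(7)
  have nex: "\<sigma> a \<noteq> []" if "a \<in> sset x \<union> sset y" for a using that ne xA yA by auto
  have eq: "\<sigma> c @- morph \<sigma> x = \<sigma> d @- morph \<sigma> y"
    using less.prems(8) ne[OF cA] ne[OF dA] by simp
  \<comment> \<open>\<open>q\<close> has the longer word and is pending afterwards, whichever letter \<open>q'\<close> was pending before\<close>
  have step: "\<exists>(\<tau> :: 'a \<Rightarrow> 'a list) \<alpha>.
    (\<forall>a\<in>A. \<tau> a \<noteq> [] \<and> \<sigma> a = concat (map \<alpha> (\<tau> a)) \<and> set (\<tau> a) \<subseteq> (\<lambda>b. hd (\<tau> b)) ` (A - {q'})) \<and>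
    (\<forall>b \<in> (\<lambda>b. hd (\<tau> b)) ` (A - {q'}). \<alpha> b \<noteq> [])"
    if pA: "p \<in> A" and qA: "q \<in> A" and pq: "p \<noteq> q" and r: "\<sigma> q = \<sigma> p @ r" "r \<noteq> []"
      and u: "sset u \<subseteq> A" and v: "sset v \<subseteq> A" and e: "morph \<sigma> u = r @- morph \<sigma> v"
      and q': "q' \<in> {p, q}"
    for p q r u v q'
  proof -
    define \<sigma>1 where "\<sigma>1 = \<sigma>(q := r)"
    define \<rho> where "\<rho> = (\<lambda>a. [a])(q := [p, q])"
    have \<rho>: "\<sigma> a = concat (map \<sigma>1 (\<rho> a))" if "a \<in> A" for a
      using r pq by (auto simp: \<rho>_def \<sigma>1_def)
    have \<rho>ne: "\<rho> a \<noteq> []" for a by (simp add: \<rho>_def)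
    have \<sigma>1ne: "\<sigma>1 a \<noteq> []" if "a \<in> A" for a using r ne[OF that] by (auto simp: \<sigma>1_def)
    have \<rho>A: "set (\<rho> a) \<subseteq> A" if "a \<in> A" for a using that pA qA by (auto simp: \<rho>_def)
    have morph1: "morph \<sigma> s = morph \<sigma>1 (morph \<rho> s)" if "sset s \<subseteq> A" for s
    proof -
      have "morph \<sigma>1 (morph \<rho> s) = morph (\<lambda>a. concat (map \<sigma>1 (\<rho> a))) s"
        using that \<rho>A by (intro morph_morph \<rho>ne \<sigma>1ne) blast
      also have "\<dots> = morph \<sigma> s" using that \<rho> by (intro morph_cong) auto
      finally show ?thesis ..
    qed
    have sA: "sset (morph \<rho> s) \<subseteq> A" if "sset s \<subseteq> A" for s
      using that \<rho>A \<rho>ne by (subst sset_morph) auto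
    define c' where "c' = shd (morph \<rho> u)"
    have "c' \<in> A" using sA[OF u] shd_sset unfolding c'_def by blast
    have "c' = hd (\<rho> (shd u))" unfolding c'_def by simp
    then have "c' \<noteq> q" using pq by (auto simp: \<rho>_def)
    have c'u: "c' ## stl (morph \<rho> u) = morph \<rho> u" unfolding c'_def by (rule stream.collapse)
    have eq1: "morph \<sigma>1 (c' ## stl (morph \<rho> u)) = morph \<sigma>1 (q ## morph \<rho> v)"
    proof -
      have "morph \<sigma>1 (q ## morph \<rho> v) = r @- morph \<sigma>1 (morph \<rho> v)"
        using r(2) by (simp add: \<sigma>1_def)
      with e show ?thesis unfolding c'u morph1[OF u] morph1[OF v] by (rule trans[OF _ sym])
    qed
    have stl1: "sset (stl (morph \<rho> u)) \<subseteq> A" using sA[OF u] stl_sset[of _ "morph \<rho> u"] by blast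
    have shorter: "(\<Sum>a\<in>A. length (\<sigma>1 a)) < (\<Sum>a\<in>A. length (\<sigma> a))"
    proof (rule sum_strict_mono_ex1)
      show "\<exists>a\<in>A. length (\<sigma>1 a) < length (\<sigma> a)"
        using qA r ne[OF pA] by (intro bexI[of _ q]) (simp_all add: \<sigma>1_def)
    qed (use \<open>finite A\<close> r in \<open>auto simp: \<sigma>1_def\<close>)
    have "\<exists>(\<tau> :: 'a \<Rightarrow> 'a list) \<alpha>.
      (\<forall>a\<in>A. \<tau> a \<noteq> [] \<and> \<sigma>1 a = concat (map \<alpha> (\<tau> a)) \<and>
              set (\<tau> a) \<subseteq> (\<lambda>b. hd (\<tau> b)) ` (A - {q})) \<and>
      (\<forall>b \<in> (\<lambda>b. hd (\<tau> b)) ` (A - {q}). \<alpha> b \<noteq> [])"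
      by (rule less.hyps[OF shorter \<open>finite A\<close> \<sigma>1ne \<open>c' \<in> A\<close> qA \<open>c' \<noteq> q\<close> stl1 sA[OF v] eq1])
    then obtain \<tau> :: "'a \<Rightarrow> 'a list" and \<alpha> where
      \<tau>: "\<And>a. a \<in> A \<Longrightarrow> \<tau> a \<noteq> [] \<and> \<sigma>1 a = concat (map \<alpha> (\<tau> a)) \<and>
              set (\<tau> a) \<subseteq> (\<lambda>b. hd (\<tau> b)) ` (A - {q})"
      and \<alpha>: "\<And>b. b \<in> (\<lambda>b. hd (\<tau> b)) ` (A - {q}) \<Longrightarrow> \<alpha> b \<noteq> []"
      by blast
    define \<tau>' where "\<tau>' a = concat (map \<tau> (\<rho> a))" for a
    have \<tau>'q: "\<tau>' q = \<tau> p @ \<tau> q" and \<tau>'o: "\<And>a. a \<noteq> q \<Longrightarrow> \<tau>' a = \<tau> a"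
      by (auto simp: \<tau>'_def \<rho>_def)
    \<comment> \<open>the images of \<open>q\<close> and \<open>p\<close> begin with the same letter, so either of them may be left out\<close>
    have hds: "(\<lambda>b. hd (\<tau>' b)) ` (A - {q'}) = (\<lambda>b. hd (\<tau> b)) ` (A - {q})"
    proof -
      have 1: "hd (\<tau>' q) = hd (\<tau> p)" using \<tau>'q \<tau>[OF pA] by simp
      have "(\<lambda>b. hd (\<tau>' b)) ` (A - {q'}) = (\<lambda>b. hd (\<tau>' b)) ` (A - {q})"
      proof (cases "q' = q")
        case False
        then have "q' = p" using q' by auto
        then have "A - {q'} = insert q (A - {p, q})" "A - {q} = insert p (A - {p, q})"
          using pA qA pq by auto
        then show ?thesis using 1 \<tau>'o[OF pq] by auto
      qed simp
      also have "\<dots> = (\<lambda>b. hd (\<tau> b)) ` (A - {q})" using \<tau>'o by (intro image_cong) auto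
      finally show ?thesis .
    qed
    show ?thesis
    proof (intro exI[of _ \<tau>'] exI[of _ \<alpha>] conjI ballI)
      fix a assume a: "a \<in> A"
      show "\<tau>' a \<noteq> []" using \<tau>[OF a] \<tau>[OF pA] \<tau>'q \<tau>'o[of a] by (cases "a = q") auto
      show "\<sigma> a = concat (map \<alpha> (\<tau>' a))"
        using \<rho>[OF a] \<tau>[OF a] \<tau>[OF pA] \<tau>[OF qA] by (cases "a = q") (auto simp: \<tau>'_def \<rho>_def)
      show "set (\<tau>' a) \<subseteq> (\<lambda>b. hd (\<tau>' b)) ` (A - {q'})"
        unfolding hds using \<tau>[OF a] \<tau>[OF pA] \<tau>'q \<tau>'o[of a] by (cases "a = q") auto
    next
      fix b assume "b \<in> (\<lambda>b. hd (\<tau>' b)) ` (A - {q'})"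
      then show "\<alpha> b \<noteq> []" unfolding hds by (rule \<alpha>)
    qed
  qed
  from eq show ?case
  proof (cases rule: shift_eq_shift_cases)
    case (1 r)
    show ?thesis
    proof (cases "r = []")
      case True
      define \<tau> where "\<tau> = (\<lambda>a. [a])(d := [c])"
      have "(\<lambda>b. hd (\<tau> b)) ` (A - {d}) = A - {d}" by (auto simp: \<tau>_def image_iff)
      then show ?thesis
        using 1 True cA cd ne by (intro exI[of _ \<tau>] exI[of _ \<sigma>]) (auto simp: \<tau>_def)
    next
      case False
      then show ?thesis using step[of d c r y x d] 1 cA dA cd xA yA by auto
    qed
  next
    case (2 r)
    show ?thesis
    proof (cases "r = []")
      case True
      define \<tau> where "\<tau> = (\<lambda>a. [a])(d := [c])"
      have "(\<lambda>b. hd (\<tau> b)) ` (A - {d}) = A - {d}" by (auto simp: \<tau>_def image_iff)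
      then show ?thesis
        using 2 True cA cd ne by (intro exI[of _ \<tau>] exI[of _ \<sigma>]) (auto simp: \<tau>_def)
    next
      case False
      then show ?thesis using step[of c d r x y d] 2 cA dA cd xA yA by auto
    qed
  qed
qed

text \<open>Morphisms that factor through a smaller alphabet are the simplifiable ones in the sense of Ehrenfeucht
  and Rozenberg. Only the letters that occur in the words \<open>\<tau> a\<close> count, so no alphabet between \<open>A\<close> and
  the target has to be named; its letters can be taken from the type of \<open>A\<close> because there are fewer.\<close>

definition defect :: "('a \<Rightarrow> 'b list) \<Rightarrow> 'a set \<Rightarrow> bool" where
  "defect \<sigma> A \<longleftrightarrow> (\<exists>(\<tau> :: 'a \<Rightarrow> 'a list) \<alpha>.
     (\<forall>a\<in>A. \<tau> a \<noteq> [] \<and> \<sigma> a = concat (map \<alpha> (\<tau> a))) \<and>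
     (\<forall>b\<in>\<Union>a\<in>A. set (\<tau> a). \<alpha> b \<noteq> []) \<and> card (\<Union>a\<in>A. set (\<tau> a)) < card A)"

text \<open>Cancelling the longest common prefix of the two words leaves two words with different first letters,
  and \<open>morphism_through_first_letters\<close> disposes of one of these letters.\<close>

lemma defect_right_infinite:
  fixes \<sigma> :: "'a \<Rightarrow> 'b list"
  assumes "finite A" and ne: "\<And>a. a \<in> A \<Longrightarrow> \<sigma> a \<noteq> []"
    and "sset x \<subseteq> A" "sset y \<subseteq> A" "x \<noteq> y" and eq: "morph \<sigma> x = morph \<sigma> y"
  shows "defect \<sigma> A"
proof -
  obtain n where n: "x !! n \<noteq> y !! n" "\<And>m. m < n \<Longrightarrow> x !! m = y !! m"
  proof -
    have "\<exists>n. x !! n \<noteq> y !! n" using \<open>x \<noteq> y\<close> by (metis smap_alt stream.map_id)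
    then show ?thesis using exists_least_iff[of "\<lambda>n. x !! n \<noteq> y !! n"] that by auto
  qed
  have st: "stake n x = stake n y" using n(2) by (intro nth_equalityI) auto
  have sub: "set (stake n x) \<subseteq> A"
    using assms(3) set_stake_subset[of n x] by blast
  have "concat (map \<sigma> (stake n x)) @- morph \<sigma> (sdrop n x) =
        concat (map \<sigma> (stake n x)) @- morph \<sigma> (sdrop n y)"
    using eq morph_shift[of "stake n x" \<sigma> "sdrop n x"] morph_shift[of "stake n y" \<sigma> "sdrop n y"] sub ne st
    by (metis stake_sdrop subsetD)
  then have "morph \<sigma> (sdrop n x) = morph \<sigma> (sdrop n y)" by simp
  moreover have "sdrop n s = s !! n ## sdrop (Suc n) s" for s :: "'a stream"
    by (metis sdrop_simps(1) sdrop_stl stream.collapse sdrop.simps(2))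
  ultimately have "morph \<sigma> (x !! n ## sdrop (Suc n) x) = morph \<sigma> (y !! n ## sdrop (Suc n) y)" by metis
  moreover have in_A: "x !! n \<in> A" "y !! n \<in> A" using assms(3,4) snth_sset by fastforce+
  moreover have "sset (sdrop (Suc n) x) \<subseteq> A" "sset (sdrop (Suc n) y) \<subseteq> A"
    using assms(3,4) sset_sdrop_subset[of "Suc n" x] sset_sdrop_subset[of "Suc n" y] by blast+
  ultimately have "\<exists>(\<tau> :: 'a \<Rightarrow> 'a list) \<alpha>.
    (\<forall>a\<in>A. \<tau> a \<noteq> [] \<and> \<sigma> a = concat (map \<alpha> (\<tau> a)) \<and>
       set (\<tau> a) \<subseteq> (\<lambda>b. hd (\<tau> b)) ` (A - {y !! n})) \<and>
    (\<forall>b \<in> (\<lambda>b. hd (\<tau> b)) ` (A - {y !! n}). \<alpha> b \<noteq> [])"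
    using n(1) by (intro morphism_through_first_letters[of A \<sigma> "x !! n" _ "sdrop (Suc n) x" "sdrop (Suc n) y"])
      (use assms in auto)
  then obtain \<tau> :: "'a \<Rightarrow> 'a list" and \<alpha> where
      \<tau>: "\<forall>a\<in>A. \<tau> a \<noteq> [] \<and> \<sigma> a = concat (map \<alpha> (\<tau> a)) \<and> set (\<tau> a) \<subseteq> (\<lambda>b. hd (\<tau> b)) ` (A - {y !! n})"
      and \<alpha>: "\<forall>b \<in> (\<lambda>b. hd (\<tau> b)) ` (A - {y !! n}). \<alpha> b \<noteq> []"
    by blast
  have "(\<Union>a\<in>A. set (\<tau> a)) \<subseteq> (\<lambda>b. hd (\<tau> b)) ` (A - {y !! n})" using \<tau> by blast
  moreover from this have "card (\<Union>a\<in>A. set (\<tau> a)) \<le> card (A - {y !! n})"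
    using \<open>finite A\<close> by (meson card_image_le card_mono finite_Diff finite_imageI le_trans)
  moreover have "card (A - {y !! n}) < card A" using \<open>finite A\<close> in_A by (metis card_Diff1_less)
  ultimately show ?thesis unfolding defect_def using \<tau> \<alpha> by (intro exI[of _ \<tau>] exI[of _ \<alpha>]) auto
qed

lemma defect_comp:
  fixes \<sigma> :: "'a \<Rightarrow> 'b list"
  assumes "\<And>a. a \<in> A \<Longrightarrow> \<tau> a \<noteq> [] \<and> \<sigma> a = concat (map \<alpha> (\<tau> a))"
    and "(\<Union>a\<in>A. set (\<tau> a)) \<subseteq> (Y :: 'a set)" "card Y \<le> card A" "defect \<alpha> Y" "finite Y"
  shows "defect \<sigma> A"
proof -
  obtain \<tau>1 :: "'a \<Rightarrow> 'a list" and \<alpha>1 where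
     1: "\<And>a. a \<in> Y \<Longrightarrow> \<tau>1 a \<noteq> [] \<and> \<alpha> a = concat (map \<alpha>1 (\<tau>1 a))"
     and 2: "\<And>b. b \<in> (\<Union>a\<in>Y. set (\<tau>1 a)) \<Longrightarrow> \<alpha>1 b \<noteq> []" and 3: "card (\<Union>a\<in>Y. set (\<tau>1 a)) < card Y"
    using \<open>defect \<alpha> Y\<close> unfolding defect_def by metis
  define \<kappa> where "\<kappa> a = concat (map \<tau>1 (\<tau> a))" for a
  have cc: "concat (map \<alpha> w) = concat (map \<alpha>1 (concat (map \<tau>1 w)))" if "set w \<subseteq> Y" for w
    using that 1 by (induction w) auto
  have sub: "(\<Union>a\<in>A. set (\<kappa> a)) \<subseteq> (\<Union>a\<in>Y. set (\<tau>1 a))" using assms(2) by (auto simp: \<kappa>_def)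
  moreover have "card (\<Union>a\<in>A. set (\<kappa> a)) \<le> card (\<Union>a\<in>Y. set (\<tau>1 a))"
    using sub \<open>finite Y\<close> by (intro card_mono) auto
  moreover have "\<kappa> a \<noteq> [] \<and> \<sigma> a = concat (map \<alpha>1 (\<kappa> a))" if "a \<in> A" for a
  proof -
    have "\<tau> a \<noteq> []" "set (\<tau> a) \<subseteq> Y" using assms that by auto
    then show ?thesis using assms(1)[OF that] cc[of "\<tau> a"] 1 unfolding \<kappa>_def
      by (metis concat_eq_Nil_conv imageI last_in_set list.set_map subsetD)
  qed
  ultimately show ?thesis unfolding defect_def using 2 3 assms(3)
    by (intro exI[of _ \<kappa>] exI[of _ \<alpha>1]) auto
qed

section \<open>Floors of stacked towers\<close>

abbreviation len :: "('a \<Rightarrow> nat) \<Rightarrow> 'a list \<Rightarrow> nat" where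
  "len h w \<equiv> sum_list (map h w)"

text \<open>A word \<open>w\<close> is read as a stack of towers, the first letter at the bottom; \<open>loc h w n\<close> is the tower and
  the floor in it at height \<open>n\<close> of the stack. Above the top of the stack, the surplus is returned as the
  floor: with this default, height \<open>0\<close> is always at a floor \<open>0\<close>, even in an empty stack.\<close>

fun loc :: "('a \<Rightarrow> nat) \<Rightarrow> 'a list \<Rightarrow> nat \<Rightarrow> 'a \<times> nat" where
  "loc h [] n = (undefined, n)"
| "loc h (y # w) n = (if n < h y then (y, n) else loc h w (n - h y))"

text \<open>If tower \<open>v\<close> is the stack \<open>\<sigma> v\<close>, its floor \<open>t\<close> lies in one of the stacked towers.\<close>

abbreviation lower :: "('b \<Rightarrow> nat) \<Rightarrow> ('a \<Rightarrow> 'b list) \<Rightarrow> 'a \<times> nat \<Rightarrow> 'b \<times> nat" where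
  "lower h \<sigma> p \<equiv> loc h (\<sigma> (fst p)) (snd p)"

lemma loc_append: "loc h (u @ w) n = (if n < len h u then loc h u n else loc h w (n - len h u))"
  by (induction u arbitrary: n) auto

lemma loc_bounds:
  assumes "n < len h w"
  shows "fst (loc h w n) \<in> set w" "snd (loc h w n) < h (fst (loc h w n))"
  using assms by (induction w arbitrary: n) auto

lemma snd_loc_0: "snd (loc h w 0) = 0"
  by (induction w) auto

lemma loc_zero: "w \<noteq> [] \<Longrightarrow> 0 < h (hd w) \<Longrightarrow> loc h w 0 = (hd w, 0)"
  by (cases w) auto

lemma loc_Suc:
  assumes "n < len h w"
  shows "Suc (snd (loc h w n)) < h (fst (loc h w n)) \<Longrightarrow>
          Suc n < len h w \<and> loc h w (Suc n) = (fst (loc h w n), Suc (snd (loc h w n)))"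
    and "\<not> Suc (snd (loc h w n)) < h (fst (loc h w n)) \<Longrightarrow> Suc n < len h w \<Longrightarrow>
          (\<And>y. y \<in> set w \<Longrightarrow> 0 < h y) \<Longrightarrow> snd (loc h w (Suc n)) = 0"
proof -
  show "Suc n < len h w \<and> loc h w (Suc n) = (fst (loc h w n), Suc (snd (loc h w n)))"
    if "Suc (snd (loc h w n)) < h (fst (loc h w n))"
    using assms that
  proof (induction w arbitrary: n)
    case (Cons y w)
    show ?case
    proof (cases "n < h y")
      case False
      then show ?thesis using Cons.IH[of "n - h y"] Cons.prems
        by (auto simp: Suc_diff_le less_diff_conv2)
    qed (use Cons.prems in auto)
  qed auto
  show "snd (loc h w (Suc n)) = 0"
    if "\<not> Suc (snd (loc h w n)) < h (fst (loc h w n))" "Suc n < len h w" "\<And>y. y \<in> set w \<Longrightarrow> 0 < h y"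
    using assms that
  proof (induction w arbitrary: n)
    case (Cons y w)
    show ?case
    proof (cases "n < h y")
      case True
      then have "Suc n = h y" using Cons.prems by auto
      moreover have "w \<noteq> []" using Cons.prems(3) \<open>Suc n = h y\<close> by auto
      ultimately show ?thesis using Cons.prems(4) by (auto simp: loc_zero)
    next
      case False
      then show ?thesis using Cons.IH[of "n - h y"] Cons.prems by (auto simp: Suc_diff_le)
    qed
  qed auto
qed

lemma loc_split:
  assumes "n < len h w" "snd (loc h w n) = 0"
  obtains u v where "w = u @ v" "len h u = n" "v \<noteq> []"
  using assms
proof (induction w arbitrary: n thesis)
  case (Cons y w)
  show ?case
  proof (cases "n < h y")
    case True
    then show ?thesis using Cons.prems(1)[of "[]" "y # w"] Cons.prems(3) by auto
  next
    case False
    then have "n - h y < len h w" "snd (loc h w (n - h y)) = 0" using Cons.prems by auto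
    then obtain u v where "w = u @ v" "len h u = n - h y" "v \<noteq> []" using Cons.IH by blast
    then show ?thesis using Cons.prems(1)[of "y # u" v] False by auto
  qed
qed auto

lemma len_concat:
  "(\<And>y. y \<in> set w \<Longrightarrow> h y = len h' (\<alpha> y)) \<Longrightarrow> len h' (concat (map \<alpha> w)) = len h w"
  by (induction w) auto

lemma loc_concat:
  assumes "\<And>y. y \<in> set w \<Longrightarrow> h y = len h' (\<alpha> y)" "n < len h w"
  shows "loc h' (concat (map \<alpha> w)) n = lower h' \<alpha> (loc h w n)"
  using assms by (induction w arbitrary: n) (auto simp: loc_append)

lemma loc_rev:
  assumes "n < len h w"
  shows "loc h (rev w) (len h w - 1 - n) = (case loc h w n of (y, t) \<Rightarrow> (y, h y - 1 - t))"
  using assms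
proof (induction w arbitrary: n)
  case (Cons y w)
  have l: "len h (rev w) = len h w" by (simp flip: rev_map)
  show ?case
  proof (cases "n < h y")
    case True
    then have "\<not> h y + len h w - 1 - n < len h w" "h y + len h w - 1 - n - len h w = h y - 1 - n"
      by auto
    then show ?thesis using True l by (simp add: loc_append)
  next
    case False
    then have *: "h y + len h w - 1 - n = len h w - 1 - (n - h y)" "n - h y < len h w"
      using Cons.prems by auto
    moreover have "len h w - 1 - (n - h y) < len h w" using * by auto
    ultimately show ?thesis using False l Cons.IH[of "n - h y"] by (simp add: loc_append)
  qed
qed auto

text \<open>As all heights are positive, the first \<open>n + 1\<close> towers of the infinite stack reach above height \<open>n\<close>.\<close>

definition sloc :: "('a \<Rightarrow> nat) \<Rightarrow> 'a stream \<Rightarrow> nat \<Rightarrow> 'a \<times> nat" where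
  "sloc h s n = loc h (stake (Suc n) s) n"

lemma le_len_stake: "(\<And>y. y \<in> sset s \<Longrightarrow> 0 < h y) \<Longrightarrow> n \<le> len h (stake n s)"
proof (induction n arbitrary: s)
  case (Suc n)
  then have "n \<le> len h (stake n (stl s))" "0 < h (shd s)"
    using stl_sset[of _ s] shd_sset[of s] by blast+
  then show ?case by simp
qed simp

lemma sloc_stake:
  assumes "\<And>y. y \<in> sset s \<Longrightarrow> 0 < h y" "n < m"
  shows "sloc h s n = loc h (stake m s) n"
proof -
  have "stake m s = stake (Suc n) s @ stake (m - Suc n) (sdrop (Suc n) s)"
    using \<open>n < m\<close> by (metis Suc_leI le_add_diff_inverse stake_add)
  moreover have "n < len h (stake (Suc n) s)" using le_len_stake[of s h "Suc n"] assms by auto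
  ultimately show ?thesis by (simp add: sloc_def loc_append del: stake.simps)
qed

lemma sloc_SCons:
  assumes "0 < h y" "\<And>z. z \<in> sset s \<Longrightarrow> 0 < h z"
  shows "sloc h (y ## s) n = (if n < h y then (y, n) else sloc h s (n - h y))"
proof (cases "n < h y")
  case False
  have "sloc h s (n - h y) = loc h (stake n s) (n - h y)"
    using False assms by (intro sloc_stake) auto
  then show ?thesis using False by (simp add: sloc_def)
qed (simp add: sloc_def)

lemma sloc_shift:
  assumes "\<And>y. y \<in> set w \<union> sset s \<Longrightarrow> 0 < h y"
  shows "sloc h (w @- s) n = (if n < len h w then loc h w n else sloc h s (n - len h w))"
  using assms
proof (induction w arbitrary: n)
  case (Cons y w)
  have "sloc h (y ## (w @- s)) n = (if n < h y then (y, n) else sloc h (w @- s) (n - h y))"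
    using Cons.prems by (intro sloc_SCons) auto
  moreover have "sloc h (w @- s) k = (if k < len h w then loc h w k else sloc h s (k - len h w))" for k
    using Cons.prems by (intro Cons.IH) auto
  ultimately show ?case by auto
qed simp

lemma sloc_morph:
  assumes "\<And>v. v \<in> sset s \<Longrightarrow> \<sigma> v \<noteq> [] \<and> h v = len h' (\<sigma> v) \<and> (\<forall>y\<in>set (\<sigma> v). 0 < h' y)"
  shows "sloc h' (morph \<sigma> s) n = lower h' \<sigma> (sloc h s n)"
proof -
  have pos: "0 < h v" if "v \<in> sset s" for v
    using assms[OF that] by (cases "\<sigma> v") auto
  let ?w = "stake (Suc n) s"
  have sub: "set ?w \<subseteq> sset s" "sset (sdrop (Suc n) s) \<subseteq> sset s"
    by (rule set_stake_subset sset_sdrop_subset)+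
  have n: "n < len h ?w" using le_len_stake[of s h "Suc n"] pos by auto
  have l: "len h' (concat (map \<sigma> ?w)) = len h ?w" using assms sub by (intro len_concat) blast
  have "morph \<sigma> s = concat (map \<sigma> ?w) @- morph \<sigma> (sdrop (Suc n) s)"
    using morph_shift[of ?w \<sigma> "sdrop (Suc n) s"] assms sub by (metis stake_sdrop subsetD)
  moreover have "sset (morph \<sigma> (sdrop (Suc n) s)) = (\<Union>a\<in>sset (sdrop (Suc n) s). set (\<sigma> a))"
    using assms sub by (intro sset_morph) blast
  moreover have "\<And>y. y \<in> set (concat (map \<sigma> ?w)) \<union> (\<Union>a\<in>sset (sdrop (Suc n) s). set (\<sigma> a)) \<Longrightarrow> 0 < h' y"
    using assms sub by (auto simp del: stake.simps sdrop.simps)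
  ultimately have "sloc h' (morph \<sigma> s) n = loc h' (concat (map \<sigma> ?w)) n"
    using n l sloc_shift[of "concat (map \<sigma> ?w)" "morph \<sigma> (sdrop (Suc n) s)" h' n] by (metis (no_types, lifting))
  also have "\<dots> = lower h' \<sigma> (loc h ?w n)"
    using n assms sub by (intro loc_concat) blast+
  finally show ?thesis unfolding sloc_def .
qed

lemma sloc_inj:
  assumes "\<And>y. y \<in> sset s \<union> sset s' \<Longrightarrow> 0 < h y" "\<And>n. sloc h s n = sloc h s' n"
  shows "s = s'"
  using assms
proof (coinduction arbitrary: s s')
  case Eq_stream
  have eq: "sloc h s n = sloc h s' n" for n using Eq_stream by blast
  obtain y u where s: "s = y ## u" by (metis stream.collapse)
  obtain y' u' where s': "s' = y' ## u'" by (metis stream.collapse)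
  have pos: "\<And>z. z \<in> sset (y ## u) \<Longrightarrow> 0 < h z" "\<And>z. z \<in> sset (y' ## u') \<Longrightarrow> 0 < h z"
    using Eq_stream s s' by blast+
  have "sloc h (y ## u) 0 = (y, 0)" "sloc h (y' ## u') 0 = (y', 0)"
    using sloc_SCons[of h y u 0] sloc_SCons[of h y' u' 0] pos by auto
  then have y: "y = y'" using eq[of 0] s s' by simp
  have "sloc h u n = sloc h u' n" for n
    using eq[of "n + h y"] s s' y pos
      sloc_SCons[of h y u "n + h y"] sloc_SCons[of h y' u' "n + h y"] by auto
  then show ?case using s s' y pos by auto
qed

text \<open>This is what an orbit sees of a partition into towers: it climbs a tower to its top and then
  enters some tower at the bottom.\<close>

definition tower_name :: "'a set \<Rightarrow> ('a \<Rightarrow> nat) \<Rightarrow> (int \<Rightarrow> 'a \<times> nat) \<Rightarrow> bool" where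
  "tower_name V h a \<longleftrightarrow> (\<forall>n. fst (a n) \<in> V \<and> snd (a n) < h (fst (a n)) \<and>
     (if Suc (snd (a n)) < h (fst (a n)) then a (n + 1) = (fst (a n), Suc (snd (a n)))
      else snd (a (n + 1)) = 0))"

lemma tower_nameD:
  assumes "tower_name V h a"
  shows "fst (a n) \<in> V" "snd (a n) < h (fst (a n))"
    "Suc (snd (a n)) < h (fst (a n)) \<Longrightarrow> a (n + 1) = (fst (a n), Suc (snd (a n)))"
    "\<not> Suc (snd (a n)) < h (fst (a n)) \<Longrightarrow> snd (a (n + 1)) = 0"
  using assms unfolding tower_name_def by metis+

lemma tower_name_within:
  assumes "tower_name V h a" "snd (a p) + n < h (fst (a p))"
  shows "a (p + int n) = (fst (a p), snd (a p) + n)"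
  using assms(2)
proof (induction n)
  case (Suc n)
  then have "a (p + int n) = (fst (a p), snd (a p) + n)" by simp
  then show ?case using tower_nameD(3)[OF assms(1), of "p + int n"] Suc.prems by (simp add: algebra_simps)
qed simp

lemma tower_name_base:
  assumes "tower_name V h a"
  shows "a (n - int (snd (a n))) = (fst (a n), 0)"
proof -
  have "t \<le> snd (a n) \<Longrightarrow> a (n - int t) = (fst (a n), snd (a n) - t)" for t
  proof (induction t)
    case (Suc t)
    define m where "m = n - int (Suc t)"
    have IH: "a (m + 1) = (fst (a n), snd (a n) - t)" using Suc unfolding m_def by simp
    have "\<not> \<not> Suc (snd (a m)) < h (fst (a m))"
    proof
      assume "\<not> Suc (snd (a m)) < h (fst (a m))"
      then have "snd (a (m + 1)) = 0" by (rule tower_nameD(4)[OF assms])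
      then show False using IH Suc.prems by simp
    qed
    then have "a (m + 1) = (fst (a m), Suc (snd (a m)))" using tower_nameD(3)[OF assms] by blast
    then have "fst (a m) = fst (a n)" "Suc (snd (a m)) = snd (a n) - t" using IH by simp_all
    then show ?case using Suc.prems unfolding m_def[symmetric] by (simp add: prod_eq_iff)
  qed simp
  from this[of "snd (a n)"] show ?thesis by simp
qed

text \<open>The towers entered after time \<open>p\<close> are the letters of \<open>s\<close>; the tower that is being climbed at time \<open>p\<close>
  is put in front, with its floors below that of time \<open>p\<close> skipped.\<close>

lemma tower_name_stream:
  assumes a: "tower_name V h a"
  obtains s where "sset s \<subseteq> V" "\<And>n. a (p + int n) = sloc h (fst (a p) ## s) (snd (a p) + n)"
proof -
  define step where "step p = p + int (h (fst (a p)) - snd (a p))" for p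
  define S where "S p = smap (\<lambda>p. fst (a p)) (siterate step p)" for p
  have S: "S p = fst (a p) ## S (step p)" for p
    unfolding S_def by (subst siterate.code) simp
  have V: "sset (S p) \<subseteq> V" for p
    unfolding S_def using tower_nameD(1)[OF a] by (auto simp: stream.set_map)
  have pos: "0 < h v" if "v \<in> sset (S p)" for v p
    using that tower_nameD(2)[OF a] unfolding S_def by (auto simp: stream.set_map) (metis gr_zeroI not_less_zero)
  have "a (p + int n) = sloc h (S p) (snd (a p) + n)" for n
  proof (induction n arbitrary: p rule: less_induct)
    case (less n)
    define m where "m = h (fst (a p)) - snd (a p)"
    have m: "0 < m" unfolding m_def using tower_nameD(2)[OF a] by simp
    have Sp: "sloc h (S p) k = (if k < h (fst (a p)) then (fst (a p), k) else sloc h (S (step p)) (k - h (fst (a p))))" for k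
      using sloc_SCons[of h "fst (a p)" "S (step p)" k] pos[of _ p] S[of p] by auto
    show ?case
    proof (cases "snd (a p) + n < h (fst (a p))")
      case True
      then show ?thesis using tower_name_within[OF a True] Sp by simp
    next
      case False
      have "a (p + int (m - 1)) = (fst (a p), snd (a p) + (m - 1))"
        by (rule tower_name_within[OF a]) (use m in \<open>simp add: m_def\<close>)
      then have "snd (a (p + int (m - 1) + 1)) = 0"
        by (intro tower_nameD(4)[OF a]) (use m in \<open>simp add: m_def\<close>)
      then have 0: "snd (a (step p)) = 0" using m unfolding step_def m_def[symmetric] by (simp add: of_nat_diff)
      have le: "m \<le> n" using False unfolding m_def by simp
      then have "a (step p + int (n - m)) = sloc h (S (step p)) (n - m)"
        using less[of "n - m" "step p"] m 0 by simp
      moreover have "step p + int (n - m) = p + int n" unfolding step_def m_def[symmetric] using le by simp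
      moreover have "snd (a p) + n - h (fst (a p)) = n - m"
        unfolding m_def using tower_nameD(2)[OF a, of p] by simp
      ultimately show ?thesis using False Sp by simp
    qed
  qed
  then show ?thesis using that[of "S (step p)"] V S by metis
qed

section \<open>The defect theorem for bi-infinite words\<close>

locale tower_morphism =
  fixes V :: "nat set" and h :: "nat \<Rightarrow> nat" and \<sigma> :: "nat \<Rightarrow> 'b list" and hW :: "'b \<Rightarrow> nat"
  assumes fin: "finite V"
    and nonempty: "v \<in> V \<Longrightarrow> \<sigma> v \<noteq> []"
    and pos_lower: "v \<in> V \<Longrightarrow> w \<in> set (\<sigma> v) \<Longrightarrow> 0 < hW w"
    and height: "v \<in> V \<Longrightarrow> h v = len hW (\<sigma> v)"
begin

lemma pos: "v \<in> V \<Longrightarrow> 0 < h v"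
  using nonempty[of v] pos_lower[of v] height[of v] by (cases "\<sigma> v") auto

lemma sloc_lower:
  assumes "sset s \<subseteq> V"
  shows "sloc hW (morph \<sigma> s) n = lower hW \<sigma> (sloc h s n)"
  using assms nonempty height pos_lower by (intro sloc_morph) blast

lemma sset_morph_pos:
  assumes "sset s \<subseteq> V" "w \<in> sset (morph \<sigma> s)"
  shows "0 < hW w"
proof -
  have "sset (morph \<sigma> s) = (\<Union>a\<in>sset s. set (\<sigma> a))" using assms nonempty by (intro sset_morph) auto
  then show ?thesis using assms pos_lower by auto
qed

text \<open>Behind a common cut \<open>m\<close> both names are sequences of complete towers. If they differ there, two
  right-infinite words over \<open>V\<close> have the same image.\<close>

lemma defect_of_common_cut:
  assumes a: "tower_name V h a" and b: "tower_name V h b"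
    and eq: "\<And>n. lower hW \<sigma> (a n) = lower hW \<sigma> (b n)"
    and cut: "snd (a m) = 0" "snd (b m) = 0" and ne: "m \<le> n" "a n \<noteq> b n"
  shows "defect \<sigma> V"
proof -
  obtain s where s: "sset s \<subseteq> V" "\<And>n. a (m + int n) = sloc h (fst (a m) ## s) n"
    using tower_name_stream[OF a, of m] cut by auto
  obtain t where t: "sset t \<subseteq> V" "\<And>n. b (m + int n) = sloc h (fst (b m) ## t) n"
    using tower_name_stream[OF b, of m] cut by auto
  let ?x = "fst (a m) ## s" and ?y = "fst (b m) ## t"
  have sub: "sset ?x \<subseteq> V" "sset ?y \<subseteq> V" using s t tower_nameD(1)[OF a] tower_nameD(1)[OF b] by auto
  have "?x \<noteq> ?y" using s(2)[of "nat (n - m)"] t(2)[of "nat (n - m)"] ne by force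
  moreover have "morph \<sigma> ?x = morph \<sigma> ?y"
  proof (rule sloc_inj)
    show "sloc hW (morph \<sigma> ?x) n = sloc hW (morph \<sigma> ?y) n" for n
      unfolding sloc_lower[OF sub(1)] sloc_lower[OF sub(2)] s(2)[symmetric] t(2)[symmetric] by (rule eq)
  qed (use sset_morph_pos[OF sub(1)] sset_morph_pos[OF sub(2)] in blast)
  ultimately show ?thesis using fin nonempty sub by (intro defect_right_infinite)
qed

text \<open>At time \<open>p\<close> the name \<open>a\<close> enters a tower while \<open>b\<close> is inside a tower \<open>\<beta>\<close>. Cut \<open>\<sigma> \<beta>\<close> there into a lower
  part \<open>u\<close> and an upper part \<open>w\<close>, and let a new letter \<open>d\<close> stand for \<open>w\<close>. The two futures of \<open>p\<close> are
  then right-infinite words over \<open>insert d V\<close> with the same image, the second of which begins with \<open>d\<close>.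
  By \<open>morphism_through_first_letters\<close> all words \<open>\<sigma> v\<close>, and \<open>u\<close> and \<open>w\<close> as well, are products of words
  \<open>\<alpha> y\<close> in which every \<open>y\<close> is the first letter for some \<open>v\<close> in \<open>V\<close>. If there are fewer letters \<open>y\<close> than
  towers, this is a defect. If not, different towers start with different letters \<open>y\<close>; moreover, both
  futures of \<open>p\<close> are the same word in the letters \<open>y\<close>, since otherwise \<open>\<alpha>\<close> would have a defect. The
  function \<open>f\<close> of the conclusion gives the floor in the towers \<open>y\<close>.\<close>

lemma defect_or_common_refinement:
  assumes a: "tower_name V h a" and b: "tower_name V h b"
    and eq: "\<And>n. lower hW \<sigma> (a n) = lower hW \<sigma> (b n)"
    and cut: "snd (a p) = 0" "snd (b p) \<noteq> 0"
  shows "defect \<sigma> V \<or> (\<exists>f :: nat \<times> nat \<Rightarrow> nat \<times> nat. inj_on (\<lambda>v. f (v, 0)) V \<and>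
           (\<forall>n. f (a (p + int n)) = f (b (p + int n))))"
proof -
  define v0 \<beta> t where "v0 = fst (a p)" and "\<beta> = fst (b p)" and "t = snd (b p)"
  have V: "v0 \<in> V" "\<beta> \<in> V" unfolding v0_def \<beta>_def by (rule tower_nameD(1)[OF a] tower_nameD(1)[OF b])+
  have t: "t < len hW (\<sigma> \<beta>)"
    using tower_nameD(2)[OF b, of p] height[OF V(2)] unfolding t_def \<beta>_def by simp
  have "loc hW (\<sigma> v0) 0 = (hd (\<sigma> v0), 0)"
    using nonempty[OF V(1)] pos_lower[OF V(1)] by (intro loc_zero) auto
  then have "snd (loc hW (\<sigma> \<beta>) t) = 0"
    using eq[of p] cut unfolding v0_def \<beta>_def t_def by (metis snd_conv)
  then obtain u w where uw: "\<sigma> \<beta> = u @ w" "len hW u = t" "w \<noteq> []" using loc_split[OF t] by metis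
  have u: "u \<noteq> []" using uw(2) cut(2) unfolding t_def by auto
  \<comment> \<open>the letter for the upper part \<open>w\<close> of \<open>\<sigma> \<beta>\<close>\<close>
  obtain d where d: "d \<notin> V" using fin ex_new_if_finite infinite_UNIV_nat by blast
  define \<sigma>' where "\<sigma>' = \<sigma>(\<beta> := u, d := w)"
  define \<rho> where "\<rho> = (\<lambda>v. [v])(\<beta> := [\<beta>, d])"
  have \<beta>d: "\<beta> \<noteq> d" using V d by auto
  obtain s where s: "sset s \<subseteq> V" "\<And>n. a (p + int n) = sloc h (v0 ## s) n"
    using tower_name_stream[OF a, of p] cut unfolding v0_def by auto
  obtain s' where s': "sset s' \<subseteq> V" "\<And>n. b (p + int n) = sloc h (\<beta> ## s') (t + n)"
    using tower_name_stream[OF b, of p] unfolding \<beta>_def t_def by auto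
  have sub: "sset (v0 ## s) \<subseteq> V" "sset (\<beta> ## s') \<subseteq> V" using s s' V by auto
  have \<rho>: "\<rho> v \<noteq> []" "hd (\<rho> v) = v" for v by (auto simp: \<rho>_def)
  have \<rho>V: "set (\<rho> v) \<subseteq> insert d V" if "v \<in> V" for v using that by (auto simp: \<rho>_def)
  have \<sigma>'ne: "\<sigma>' v \<noteq> []" if "v \<in> insert d V" for v
    using that nonempty u uw(3) by (auto simp: \<sigma>'_def)
  have \<sigma>'\<rho>: "\<sigma> v = concat (map \<sigma>' (\<rho> v))" if "v \<in> V" for v
    using that d \<beta>d uw(1) by (auto simp: \<sigma>'_def \<rho>_def)
  have morph': "morph \<sigma>' (morph \<rho> r) = morph \<sigma> r" if r: "sset r \<subseteq> V" for r
  proof -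
    have "morph \<sigma>' (morph \<rho> r) = morph (\<lambda>a. concat (map \<sigma>' (\<rho> a))) r"
      using r \<rho>V by (intro morph_morph \<rho> \<sigma>'ne) blast
    also have "\<dots> = morph \<sigma> r" using r \<sigma>'\<rho> by (intro morph_cong) auto
    finally show ?thesis .
  qed
  have morph_\<beta>: "morph \<sigma> (\<beta> ## s') = u @- (w @- morph \<sigma> s')"
    using uw u by simp
  have tails: "morph \<sigma> (v0 ## s) = w @- morph \<sigma> s'"
  proof (rule sloc_inj)
    have pos': "0 < hW y" if "y \<in> sset (u @- (w @- morph \<sigma> s'))" for y
      using that sset_morph_pos[OF sub(2)] unfolding morph_\<beta> by blast
    show "0 < hW y" if "y \<in> sset (morph \<sigma> (v0 ## s)) \<union> sset (w @- morph \<sigma> s')" for y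
      using that pos' sset_morph_pos[OF sub(1), of y] by (metis Un_iff sset_shift)
    fix n
    have "sloc hW (w @- morph \<sigma> s') n = sloc hW (u @- (w @- morph \<sigma> s')) (t + n)"
      using sloc_shift[of u "w @- morph \<sigma> s'" hW "t + n"] pos' uw(2) by (simp only: sset_shift) simp
    also have "\<dots> = lower hW \<sigma> (b (p + int n))"
      unfolding morph_\<beta>[symmetric] sloc_lower[OF sub(2)] s'(2) ..
    also have "\<dots> = sloc hW (morph \<sigma> (v0 ## s)) n"
      unfolding sloc_lower[OF sub(1)] s(2)[symmetric] by (rule eq[symmetric])
    finally show "sloc hW (morph \<sigma> (v0 ## s)) n = sloc hW (w @- morph \<sigma> s') n" ..
  qed
  have hat: "sset (morph \<rho> r) \<subseteq> insert d V" if "sset r \<subseteq> V" for r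
  proof -
    have "sset (morph \<rho> r) = (\<Union>a\<in>sset r. set (\<rho> a))" using \<rho> by (intro sset_morph)
    then show ?thesis using that \<rho>V by blast
  qed
  define x where "x = morph \<rho> (v0 ## s)"
  have x: "shd x = v0" unfolding x_def using \<rho>[of v0] by simp
  have xx: "v0 ## stl x = x" using x by (metis stream.collapse)
  have stlx: "sset (stl x) \<subseteq> insert d V"
    using hat[OF sub(1)] stl_sset[of _ x] unfolding x_def[symmetric] by blast
  have eqx: "morph \<sigma>' (v0 ## stl x) = morph \<sigma>' (d ## morph \<rho> s')"
  proof -
    have "morph \<sigma>' (d ## morph \<rho> s') = w @- morph \<sigma>' (morph \<rho> s')"
      using uw(3) by (simp add: \<sigma>'_def)
    moreover have "morph \<sigma>' x = w @- morph \<sigma> s'" unfolding x_def morph'[OF sub(1)] by (rule tails)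
    ultimately show ?thesis unfolding xx morph'[OF s'(1)] by (rule trans[OF _ sym, rotated])
  qed
  have v0d: "v0 \<noteq> d" using V d by auto
  have Ad: "insert d V - {d} = V" using d by auto
  have "\<exists>(\<tau> :: nat \<Rightarrow> nat list) \<alpha>.
    (\<forall>a\<in>insert d V. \<tau> a \<noteq> [] \<and> \<sigma>' a = concat (map \<alpha> (\<tau> a)) \<and>
       set (\<tau> a) \<subseteq> (\<lambda>b. hd (\<tau> b)) ` (insert d V - {d})) \<and>
    (\<forall>b \<in> (\<lambda>b. hd (\<tau> b)) ` (insert d V - {d}). \<alpha> b \<noteq> [])"
    by (rule morphism_through_first_letters[OF _ \<sigma>'ne _ _ v0d stlx hat[OF s'(1)] eqx])
      (use fin V in auto)
  then obtain \<tau>' :: "nat \<Rightarrow> nat list" and \<alpha> where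
     \<tau>': "\<And>a. a \<in> insert d V \<Longrightarrow> \<tau>' a \<noteq> [] \<and> \<sigma>' a = concat (map \<alpha> (\<tau>' a)) \<and> set (\<tau>' a) \<subseteq> (\<lambda>b. hd (\<tau>' b)) ` V"
     and \<alpha>: "\<And>b. b \<in> (\<lambda>b. hd (\<tau>' b)) ` V \<Longrightarrow> \<alpha> b \<noteq> []"
    unfolding Ad by blast
  define Y where "Y = (\<lambda>b. hd (\<tau>' b)) ` V"
  define \<tau> where "\<tau> v = concat (map \<tau>' (\<rho> v))" for v
  have \<tau>\<beta>: "\<tau> \<beta> = \<tau>' \<beta> @ \<tau>' d" and \<tau>o: "\<And>v. v \<noteq> \<beta> \<Longrightarrow> \<tau> v = \<tau>' v" by (auto simp: \<tau>_def \<rho>_def)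
  have \<tau>Y: "set (\<tau> v) \<subseteq> Y" if "v \<in> V" for v
    using \<tau>'[of v] \<tau>'[of d] that \<tau>\<beta> \<tau>o[of v] unfolding Y_def by (cases "v = \<beta>") auto
  have \<tau>ne: "\<tau> v \<noteq> []" and hd\<tau>: "hd (\<tau> v) = hd (\<tau>' v)" if "v \<in> V" for v
    using \<tau>'[of v] that \<tau>\<beta> \<tau>o[of v] by (cases "v = \<beta>"; simp)+
  have \<alpha>\<tau>': "concat (map \<alpha> (\<tau>' \<beta>)) = u" "concat (map \<alpha> (\<tau>' d)) = w"
    using \<tau>'[of \<beta>] \<tau>'[of d] V \<beta>d by (auto simp: \<sigma>'_def)
  have \<sigma>\<tau>: "\<sigma> v = concat (map \<alpha> (\<tau> v))" if "v \<in> V" for v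
  proof (cases "v = \<beta>")
    case True
    then show ?thesis using \<alpha>\<tau>' uw(1) \<tau>\<beta> by simp
  next
    case False
    then show ?thesis using \<tau>'[of v] that d \<tau>o[of v] by (auto simp: \<sigma>'_def split: if_splits)
  qed
  have finY: "finite Y" unfolding Y_def using fin by simp
  have cardY: "card Y \<le> card V" unfolding Y_def using fin by (rule card_image_le)
  have unY: "(\<Union>v\<in>V. set (\<tau> v)) \<subseteq> Y" using \<tau>Y by auto
  show ?thesis
  proof (cases "card Y < card V")
    case True
    have "card (\<Union>v\<in>V. set (\<tau> v)) \<le> card Y" by (intro card_mono finY unY)
    then have "defect \<sigma> V"
      unfolding defect_def using True \<tau>ne \<sigma>\<tau> \<alpha> unY
      by (intro exI[of _ \<tau>] exI[of _ \<alpha>]) (auto simp: Y_def)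
    then show ?thesis ..
  next
    case False
    then have "card Y = card V" using cardY by simp
    then have inj: "inj_on (\<lambda>v. hd (\<tau>' v)) V" unfolding Y_def using fin by (intro eq_card_imp_inj_on)
    \<comment> \<open>the futures of \<open>a\<close> and \<open>b\<close> as words in the letters \<open>y\<close>\<close>
    define zx where "zx = morph \<tau> (v0 ## s)"
    define zy where "zy = \<tau>' d @- morph \<tau> s'"
    have \<alpha>Y: "\<alpha> y \<noteq> []" if "y \<in> Y" for y using \<alpha> that unfolding Y_def by blast
    have zr: "sset (morph \<tau> r) \<subseteq> Y" "morph \<alpha> (morph \<tau> r) = morph \<sigma> r" if r: "sset r \<subseteq> V" for r
    proof -
      have "sset (morph \<tau> r) = (\<Union>a\<in>sset r. set (\<tau> a))" using \<tau>ne r by (intro sset_morph) blast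
      then show "sset (morph \<tau> r) \<subseteq> Y" using r \<tau>Y by blast
      have "morph \<alpha> (morph \<tau> r) = morph (\<lambda>a. concat (map \<alpha> (\<tau> a))) r"
        using r \<tau>Y \<tau>ne \<alpha>Y by (intro morph_morph) blast+
      also have "\<dots> = morph \<sigma> r" using r \<sigma>\<tau> by (intro morph_cong) auto
      finally show "morph \<alpha> (morph \<tau> r) = morph \<sigma> r" .
    qed
    have \<tau>'dY: "set (\<tau>' d) \<subseteq> Y" using \<tau>'[of d] unfolding Y_def by auto
    have zyY: "sset zy \<subseteq> Y" unfolding zy_def using \<tau>'dY zr(1)[OF s'(1)] by simp
    have \<alpha>zy: "morph \<alpha> zy = w @- morph \<sigma> s'"
      using morph_shift[of "\<tau>' d" \<alpha> "morph \<tau> s'"] \<tau>'dY \<alpha>Y unfolding zy_def \<alpha>\<tau>' zr(2)[OF s'(1)] by blast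
    show ?thesis
    proof (cases "zx = zy")
      case False
      have "defect \<alpha> Y"
        using finY \<alpha>Y zr(1)[OF sub(1)] zyY False zr(2)[OF sub(1)] \<alpha>zy tails
        unfolding zx_def by (intro defect_right_infinite[of Y \<alpha> "morph \<tau> (v0 ## s)" zy]) simp_all
      then have "defect \<sigma> V" using \<tau>ne \<sigma>\<tau> unY cardY finY by (intro defect_comp[of V \<tau> \<sigma> \<alpha> Y]) auto
      then show ?thesis ..
    next
      case True
      define hY where "hY y = len hW (\<alpha> y)" for y
      have hYpos: "0 < hY y" if "y \<in> Y" for y
      proof -
        obtain v where v: "v \<in> V" "y = hd (\<tau>' v)" using \<open>y \<in> Y\<close> unfolding Y_def by blast
        then have "y \<in> set (\<tau> v)" using \<tau>ne hd\<tau> by (metis hd_in_set)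
        then have "set (\<alpha> y) \<subseteq> set (\<sigma> v)" using \<sigma>\<tau>[OF v(1)] by auto
        then show ?thesis using \<alpha>Y[OF that] pos_lower[OF v(1)] unfolding hY_def
          by (cases "\<alpha> y") auto
      qed
      interpret Y: tower_morphism V h \<tau> hY
      proof
        fix v w assume "v \<in> V" "w \<in> set (\<tau> v)"
        then show "0 < hY w" using hYpos \<tau>Y by blast
      next
        fix v assume "v \<in> V"
        then show "h v = len hY (\<tau> v)"
          using height[of v] \<sigma>\<tau>[of v] len_concat[of "\<tau> v" hY hW \<alpha>] unfolding hY_def by simp
      qed (use fin \<tau>ne in auto)
      have hdY: "hd (\<tau> v) \<in> Y" if "v \<in> V" for v using \<tau>ne[OF that] \<tau>Y[OF that] by (meson hd_in_set subsetD)
      have f0: "lower hY \<tau> (v, 0) = (hd (\<tau>' v), 0)" if "v \<in> V" for v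
        using loc_zero[OF \<tau>ne[OF that], of hY] hYpos[OF hdY[OF that]] hd\<tau>[OF that] by simp
      have "inj_on (\<lambda>v. lower hY \<tau> (v, 0)) V"
        using inj f0 by (auto simp: inj_on_def)
      moreover have "lower hY \<tau> (a (p + int n)) = lower hY \<tau> (b (p + int n))" for n
      proof -
        have len\<beta>: "len hY (\<tau>' \<beta>) = t"
          using len_concat[of "\<tau>' \<beta>" hY hW \<alpha>] uw(2) unfolding \<alpha>\<tau>' hY_def by simp
        have m: "morph \<tau> (\<beta> ## s') = \<tau>' \<beta> @- zy"
          unfolding zy_def using \<tau>\<beta> \<tau>'[of \<beta>] V by simp
        have "lower hY \<tau> (a (p + int n)) = sloc hY zx n"
          unfolding zx_def Y.sloc_lower[OF sub(1)] s(2) ..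
        also have "\<dots> = sloc hY (\<tau>' \<beta> @- zy) (t + n)"
          using sloc_shift[of "\<tau>' \<beta>" zy hY "t + n"] Y.sset_morph_pos[OF sub(2)] unfolding m True len\<beta>
          by (simp only: sset_shift) simp
        also have "\<dots> = lower hY \<tau> (b (p + int n))"
          unfolding m[symmetric] Y.sloc_lower[OF sub(2)] s'(2) ..
        finally show ?thesis .
      qed
      ultimately show ?thesis by (intro disjI2 exI[of _ "lower hY \<tau>"]) simp
    qed
  qed
qed

text \<open>Let \<open>a\<close> enter a tower at time \<open>p\<close>, and take \<open>f\<close> from \<open>defect_or_common_refinement\<close>. When \<open>a\<close> or \<open>b\<close>
  enters a new tower after \<open>p\<close>, the other one is inside a tower, and its next value of \<open>f\<close> tells which
  tower is entered. So from \<open>p\<close> on the pair of addresses evolves deterministically in a finite set; it is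
  periodic after at most \<open>N\<close> steps with a period of at most \<open>N\<close>. Neither bound depends on \<open>p\<close>, and \<open>p\<close> may
  be chosen arbitrarily far in the past.\<close>

lemma periodic_of_no_common_cut:
  assumes a: "tower_name V h a" and b: "tower_name V h b"
    and eq: "\<And>n. lower hW \<sigma> (a n) = lower hW \<sigma> (b n)"
    and no_cut: "\<And>n. snd (a n) \<noteq> 0 \<or> snd (b n) \<noteq> 0" and "\<not> defect \<sigma> V"
  shows "\<exists>q::nat>0. \<forall>n. a (n + int q) = a n"
proof -
  define Q where "Q = (SIGMA v:V. {..<h v})"
  define N where "N = card (Q \<times> Q)"
  define state where "state n = (a n, b n)" for n
  have finQ: "finite (Q \<times> Q)" unfolding Q_def using fin by simp
  have inQ: "state n \<in> Q \<times> Q" for n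
    unfolding state_def Q_def using tower_nameD(1,2)[OF a, of n] tower_nameD(1,2)[OF b, of n]
    by (cases "a n"; cases "b n") auto
  have tail: "a (n + int (fact N)) = a n" if p: "snd (a p) = 0" and n: "p + int N \<le> n" for p n
  proof -
    obtain f :: "nat \<times> nat \<Rightarrow> nat \<times> nat" where inj: "inj_on (\<lambda>v. f (v, 0)) V"
      and f: "\<And>n. f (a (p + int n)) = f (b (p + int n))"
      using defect_or_common_refinement[OF a b eq p] no_cut[of p] p \<open>\<not> defect \<sigma> V\<close> by auto
    have f': "f (a n) = f (b n)" if "p \<le> n" for n
      using f[of "nat (n - p)"] that by simp
    \<comment> \<open>the value of \<open>f\<close> at the bottom of a tower determines the tower\<close>
    have fall: "c (m + 1) = c (n + 1)"
      if c: "tower_name V h c" and "snd (c (m + 1)) = 0" "snd (c (n + 1)) = 0"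
        "f (c (m + 1)) = f (c (n + 1))" for c m n
    proof -
      have "fst (c (m + 1)) = fst (c (n + 1))"
        using that(2-4) tower_nameD(1)[OF c]
        by (intro inj_onD[OF inj]) (metis prod.collapse)+
      then show ?thesis using that by (simp add: prod_eq_iff)
    qed
    have det1: "state (m + 1) = state (n + 1)" if mn: "p \<le> m" "p \<le> n" "state m = state n" for m n
    proof -
      have an: "a m = a n" and bn: "b m = b n" using mn unfolding state_def by auto
      have fa: "f (a (m + 1)) = f (b (m + 1))" "f (a (n + 1)) = f (b (n + 1))" using f' mn by auto
      consider "Suc (snd (a n)) < h (fst (a n))" "Suc (snd (b n)) < h (fst (b n))"
        | "Suc (snd (a n)) < h (fst (a n))" "\<not> Suc (snd (b n)) < h (fst (b n))"
        | "\<not> Suc (snd (a n)) < h (fst (a n))" "Suc (snd (b n)) < h (fst (b n))"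
        | "\<not> Suc (snd (a n)) < h (fst (a n))" "\<not> Suc (snd (b n)) < h (fst (b n))" by blast
      then show ?thesis
      proof cases
        case 1
        then show ?thesis using tower_nameD(3)[OF a, of m] tower_nameD(3)[OF a, of n]
            tower_nameD(3)[OF b, of m] tower_nameD(3)[OF b, of n] an bn unfolding state_def by simp
      next
        case 2
        then have "a (m + 1) = a (n + 1)" using tower_nameD(3)[OF a, of m] tower_nameD(3)[OF a, of n] an by simp
        moreover have "b (m + 1) = b (n + 1)"
          using 2 tower_nameD(4)[OF b, of m] tower_nameD(4)[OF b, of n] bn fa calculation
          by (intro fall[OF b]) simp_all
        ultimately show ?thesis unfolding state_def by simp
      next
        case 3
        then have "b (m + 1) = b (n + 1)" using tower_nameD(3)[OF b, of m] tower_nameD(3)[OF b, of n] bn by simp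
        moreover have "a (m + 1) = a (n + 1)"
          using 3 tower_nameD(4)[OF a, of m] tower_nameD(4)[OF a, of n] an fa calculation
          by (intro fall[OF a]) simp_all
        ultimately show ?thesis unfolding state_def by simp
      next
        case 4
        then show ?thesis using tower_nameD(4)[OF a, of n] tower_nameD(4)[OF b, of n] no_cut[of "n + 1"] by simp
      qed
    qed
    have det: "state (m + int k) = state (n + int k)" if "p \<le> m" "p \<le> n" "state m = state n" for m n k
    proof (induction k)
      case (Suc k)
      then show ?case using det1[of "m + int k" "n + int k"] that by (simp add: algebra_simps)
    qed (use that in simp)
    have "\<not> inj_on (\<lambda>i. state (p + int i)) {..N}"
    proof
      assume "inj_on (\<lambda>i. state (p + int i)) {..N}"
      then have "card {..N} \<le> N" unfolding N_def using inQ finQ by (intro card_inj_on_le[of _ _ "Q \<times> Q"] image_subsetI)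
      then show False by simp
    qed
    then obtain i j where ij: "i < j" "j \<le> N" "state (p + int i) = state (p + int j)"
      unfolding inj_on_def by (metis atMost_iff linorder_neqE_nat)
    define d where "d = j - i"
    have period: "state (p + int i + int k + int d) = state (p + int i + int k)" for k
      using det[of "p + int i" "p + int j" k] ij unfolding d_def by (simp add: of_nat_diff algebra_simps)
    have periods: "state (p + int i + int k + int (c * d)) = state (p + int i + int k)" for k c
    proof (induction c)
      case (Suc c)
      then show ?case using period[of "k + c * d"] by (simp add: algebra_simps)
    qed simp
    \<comment> \<open>\<open>fact N\<close> serves as a period for all \<open>p\<close> at once\<close>
    have "d dvd fact N" using ij unfolding d_def by (intro dvd_fact) auto
    then obtain c where "fact N = c * d" by (metis dvd_def mult.commute)
    moreover have "n = p + int i + int (nat (n - p - int i))" using n ij by simp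
    ultimately have "state (n + int (fact N)) = state n" using periods by metis
    then show ?thesis unfolding state_def by simp
  qed
  show ?thesis
  proof (intro exI[of _ "fact N"] conjI allI)
    fix n
    define p where "p = n - int N - int (snd (a (n - int N)))"
    have "snd (a p) = 0" unfolding p_def by (simp add: tower_name_base[OF a])
    then show "a (n + int (fact N)) = a n" by (rule tail) (simp add: p_def)
  qed simp
qed

text \<open>If the two names have a cut in common and differ behind it, \<open>\<sigma>\<close> has a defect; if they differ before it,
  the same applies after reversal of time.\<close>

theorem defect_or_periodic:
  assumes a: "tower_name V h a" and b: "tower_name V h b"
    and eq: "\<And>n. lower hW \<sigma> (a n) = lower hW \<sigma> (b n)" and ne: "a \<noteq> b"
  shows "defect \<sigma> V \<or> (\<exists>q::nat>0. \<forall>n. a (n + int q) = a n)"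
proof (cases "\<exists>m. snd (a m) = 0 \<and> snd (b m) = 0")
  case False
  then have "snd (a n) \<noteq> 0 \<or> snd (b n) \<noteq> 0" for n by metis
  then have "\<exists>q::nat>0. \<forall>n. a (n + int q) = a n" if "\<not> defect \<sigma> V"
    by (rule periodic_of_no_common_cut[OF a b eq _ that])
  then show ?thesis by metis
next
  case True
  then obtain m where m: "snd (a m) = 0" "snd (b m) = 0" by blast
  obtain n where n: "a n \<noteq> b n" using ne by blast
  show ?thesis
  proof (cases "m \<le> n")
    case True
    then show ?thesis using defect_of_common_cut[OF a b eq m True n] by blast
  next
    case False
    interpret R: tower_morphism V h "\<lambda>v. rev (\<sigma> v)" hW
      using fin nonempty pos_lower height by unfold_locales (auto simp flip: rev_map)
    \<comment> \<open>time runs backwards, and floors are counted from the top\<close>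
    define flip where "flip c = (\<lambda>n. (fst (c (- n)), h (fst (c (- n))) - 1 - snd (c (- n))))"
      for c :: "int \<Rightarrow> nat \<times> nat"
    have pred: "if snd (c (k + 1)) = 0 then Suc (snd (c k)) = h (fst (c k))
        else c (k + 1) = (fst (c k), Suc (snd (c k)))" if c: "tower_name V h c" for c k
      using tower_nameD[OF c, of k] by (cases "Suc (snd (c k)) < h (fst (c k))") auto
    have flip: "tower_name V h (flip c)" if c: "tower_name V h c" for c
      unfolding tower_name_def
    proof
      fix n :: int
      define k where "k = - n - 1"
      have k: "- n = k + 1" "- (n + 1) = k" unfolding k_def by auto
      have *: "snd (c k) < h (fst (c k))" "snd (c (k + 1)) < h (fst (c (k + 1)))"
        using tower_nameD(2)[OF c] by blast+
      show "fst (flip c n) \<in> V \<and> snd (flip c n) < h (fst (flip c n)) \<and>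
        (if Suc (snd (flip c n)) < h (fst (flip c n)) then flip c (n + 1) = (fst (flip c n), Suc (snd (flip c n)))
         else snd (flip c (n + 1)) = 0)"
        using pred[OF c, of k] * tower_nameD(1)[OF c, of "k + 1"] unfolding flip_def k
        by (cases "snd (c (k + 1)) = 0") auto
    qed
    have flip_lower: "lower hW (\<lambda>v. rev (\<sigma> v)) (flip c n) =
        (case lower hW \<sigma> (c (- n)) of (y, t) \<Rightarrow> (y, hW y - 1 - t))" if c: "tower_name V h c" for c n
      using loc_rev[of "snd (c (- n))" hW "\<sigma> (fst (c (- n)))"] height tower_nameD(1,2)[OF c, of "- n"]
      unfolding flip_def by simp
    have flip_inj: "c (- n) = c' (- n)" if "flip c n = flip c' n" "tower_name V h c" "tower_name V h c'" for c c' n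
      using that tower_nameD(2)[OF that(2), of "- n"] tower_nameD(2)[OF that(3), of "- n"]
      unfolding flip_def by (auto simp: prod_eq_iff)
    have "defect (\<lambda>v. rev (\<sigma> v)) V"
    proof (rule R.defect_of_common_cut[OF flip[OF a] flip[OF b]])
      show "lower hW (\<lambda>v. rev (\<sigma> v)) (flip a n) = lower hW (\<lambda>v. rev (\<sigma> v)) (flip b n)" for n
        unfolding flip_lower[OF a] flip_lower[OF b] eq ..
      show "snd (flip a (1 - m)) = 0" "snd (flip b (1 - m)) = 0"
        using pred[OF a, of "m - 1"] pred[OF b, of "m - 1"] m unfolding flip_def by auto
      show "1 - m \<le> - n" using False by simp
      show "flip a (- n) \<noteq> flip b (- n)" using flip_inj[OF _ a b, of "- n"] n by auto
    qed
    then obtain \<tau> :: "nat \<Rightarrow> nat list" and \<alpha> where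
      \<tau>: "\<forall>v\<in>V. \<tau> v \<noteq> [] \<and> rev (\<sigma> v) = concat (map \<alpha> (\<tau> v))" and
      \<alpha>: "\<forall>b\<in>\<Union>v\<in>V. set (\<tau> v). \<alpha> b \<noteq> []" "card (\<Union>v\<in>V. set (\<tau> v)) < card V"
      unfolding defect_def by blast
    have "\<sigma> v = concat (map (\<lambda>y. rev (\<alpha> y)) (rev (\<tau> v)))" if "v \<in> V" for v
    proof -
      have "\<sigma> v = rev (concat (map \<alpha> (\<tau> v)))" using \<tau> that by (metis rev_rev_ident)
      then show ?thesis by (simp add: rev_concat rev_map o_def)
    qed
    with \<tau> \<alpha> have "defect \<sigma> V"
      unfolding defect_def by (intro exI[of _ "\<lambda>v. rev (\<tau> v)"] exI[of _ "\<lambda>y. rev (\<alpha> y)"]) simp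
    then show ?thesis ..
  qed
qed

end

section \<open>Integer iterates\<close>

lemma int_iterate_0: "int_iterate A S 0 x = x"
  by (simp add: int_iterate_def)

lemma int_iterate_step:
  assumes S: "bij_betw S A A" and x: "x \<in> A"
  shows "int_iterate A S m x \<in> A" "int_iterate A S (m + 1) x = S (int_iterate A S m x)"
proof -
  define R where "R = inv_into A S"
  have SA: "S y \<in> A" if "y \<in> A" for y using S that by (auto simp: bij_betw_def)
  have RA: "R y \<in> A" "S (R y) = y" if "y \<in> A" for y
    using S that unfolding R_def by (auto simp: bij_betw_def inv_into_into f_inv_into_f)
  have pow: "(S ^^ k) x \<in> A" "(R ^^ k) x \<in> A" for k using SA RA x by (induction k) auto
  show "int_iterate A S m x \<in> A" using pow unfolding int_iterate_def R_def by simp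
  show "int_iterate A S (m + 1) x = S (int_iterate A S m x)"
  proof (cases "0 \<le> m")
    case True
    then have "nat (m + 1) = Suc (nat m)" by simp
    then show ?thesis using True unfolding int_iterate_def by simp
  next
    case False
    then have n: "nat (- m) = Suc (nat (- (m + 1)))" by simp
    have "S (int_iterate A S m x) = (R ^^ nat (- (m + 1))) x"
      using False RA(2)[OF pow(2)] unfolding int_iterate_def R_def[symmetric] n by simp
    also have "\<dots> = int_iterate A S (m + 1) x"
      using False unfolding int_iterate_def R_def[symmetric] by (cases "m = - 1") auto
    finally show ?thesis ..
  qed
qed

lemma int_iterate_add:
  assumes S: "bij_betw S A A" and x: "x \<in> A"
  shows "int_iterate A S (m + n) x = int_iterate A S m (int_iterate A S n x)"
proof (induction m rule: int_induct[where k = 0])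
  case base
  then show ?case by (simp add: int_iterate_0)
next
  case (step1 i)
  have "int_iterate A S (i + 1 + n) x = S (int_iterate A S (i + n) x)"
    using int_iterate_step(2)[OF S x, of "i + n"] by (simp add: algebra_simps)
  also have "\<dots> = int_iterate A S (i + 1) (int_iterate A S n x)"
    using step1 int_iterate_step(2)[OF S int_iterate_step(1)[OF S x], of i n] by simp
  finally show ?case .
next
  case (step2 i)
  have "S (int_iterate A S (i - 1 + n) x) = S (int_iterate A S (i - 1) (int_iterate A S n x))"
    using step2 int_iterate_step(2)[OF S int_iterate_step(1)[OF S x], of "i - 1" n]
      int_iterate_step(2)[OF S x, of "i - 1 + n"] by (simp add: algebra_simps)
  then show ?case
    using S int_iterate_step(1)[OF S x] int_iterate_step(1)[OF S int_iterate_step(1)[OF S x]]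
    by (metis bij_betw_imp_inj_on inj_onD)
qed

section \<open>Partitions into towers\<close>

text \<open>A partition of the space into towers is recorded by the function \<open>address\<close> which sends a point to its
  tower and floor, so that a refinement is an equation between addresses.\<close>

record 'a towers =
  labels :: "nat set"
  height :: "nat \<Rightarrow> nat"
  address :: "'a \<Rightarrow> nat \<times> nat"

text \<open>These are the Kakutani--Rokhlin partitions. Continuity of the address makes each floor clopen.\<close>

definition tower_partition :: "'a topology \<Rightarrow> ('a \<Rightarrow> 'a) \<Rightarrow> 'a towers \<Rightarrow> bool" where
  "tower_partition T S P \<longleftrightarrow>
     finite (labels P) \<and> (\<forall>v\<in>labels P. 0 < height P v) \<and>
     continuous_map T (discrete_topology UNIV) (address P) \<and>
     (\<forall>x\<in>topspace T. fst (address P x) \<in> labels P \<and> snd (address P x) < height P (fst (address P x)) \<and>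
        (if Suc (snd (address P x)) < height P (fst (address P x))
         then address P (S x) = (fst (address P x), Suc (snd (address P x)))
         else snd (address P (S x)) = 0))"

text \<open>\<open>\<sigma> v\<close> lists the towers of \<open>P\<close> of which the tower \<open>v\<close> of \<open>Q\<close> consists, from bottom to top.\<close>

definition refines_via :: "'a set \<Rightarrow> 'a towers \<Rightarrow> 'a towers \<Rightarrow> (nat \<Rightarrow> nat list) \<Rightarrow> bool" where
  "refines_via X P Q \<sigma> \<longleftrightarrow>
     (\<forall>v\<in>labels Q. \<sigma> v \<noteq> [] \<and> set (\<sigma> v) \<subseteq> labels P \<and> height Q v = len (height P) (\<sigma> v)) \<and>
     (\<forall>x\<in>X. address P x = lower (height P) \<sigma> (address Q x))"

definition refines :: "'a set \<Rightarrow> 'a towers \<Rightarrow> 'a towers \<Rightarrow> bool" where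
  "refines X P Q \<longleftrightarrow> (\<exists>\<sigma>. refines_via X P Q \<sigma>)"

text \<open>In a compact space, the last condition makes the floors of all levels a base of the topology.\<close>

definition tower_scheme :: "'a topology \<Rightarrow> ('a \<Rightarrow> 'a) \<Rightarrow> nat \<Rightarrow> (nat \<Rightarrow> 'a towers) \<Rightarrow> bool" where
  "tower_scheme T S K P \<longleftrightarrow>
     (\<forall>i. tower_partition T S (P i) \<and> card (labels (P i)) \<le> K \<and> refines (topspace T) (P i) (P (Suc i))) \<and>
     (\<forall>x\<in>topspace T. \<forall>y\<in>topspace T. (\<forall>i. address (P i) x = address (P i) y) \<longrightarrow> x = y)"

lemma refines_address:
  assumes "refines X P Q" "x \<in> X" "y \<in> X" "address Q x = address Q y"
  shows "address P x = address P y"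
  using assms unfolding refines_def refines_via_def by metis

lemma tower_partitionD:
  assumes "tower_partition T S P"
  shows "finite (labels P)" "v \<in> labels P \<Longrightarrow> 0 < height P v"
    "continuous_map T (discrete_topology UNIV) (address P)"
    "x \<in> topspace T \<Longrightarrow> fst (address P x) \<in> labels P"
    "x \<in> topspace T \<Longrightarrow> snd (address P x) < height P (fst (address P x))"
    "x \<in> topspace T \<Longrightarrow> if Suc (snd (address P x)) < height P (fst (address P x))
         then address P (S x) = (fst (address P x), Suc (snd (address P x)))
         else snd (address P (S x)) = 0"
  using assms unfolding tower_partition_def by blast+

lemma refines_trans:
  assumes "refines (topspace T) P Q" "refines (topspace T) Q R" "tower_partition T S R"
  shows "refines (topspace T) P R"
proof -
  obtain \<sigma> where \<sigma>: "refines_via (topspace T) P Q \<sigma>" using assms(1) unfolding refines_def by blast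
  obtain \<tau> where \<tau>: "refines_via (topspace T) Q R \<tau>" using assms(2) unfolding refines_def by blast
  have len: "height Q v = len (height P) (\<sigma> v)" if "v \<in> labels Q" for v
    using \<sigma> that unfolding refines_via_def by blast
  have "refines_via (topspace T) P R (\<lambda>v. concat (map \<sigma> (\<tau> v)))"
    unfolding refines_via_def
  proof (intro conjI ballI)
    fix v assume v: "v \<in> labels R"
    have \<tau>v: "\<tau> v \<noteq> []" "set (\<tau> v) \<subseteq> labels Q" "height R v = len (height Q) (\<tau> v)"
      using \<tau> v unfolding refines_via_def by auto
    have \<sigma>w: "\<sigma> w \<noteq> []" "set (\<sigma> w) \<subseteq> labels P" if "w \<in> set (\<tau> v)" for w
      using \<sigma> that \<tau>v(2) unfolding refines_via_def by auto
    show "concat (map \<sigma> (\<tau> v)) \<noteq> []" using \<tau>v(1) \<sigma>w(1) by (cases "\<tau> v") auto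
    show "set (concat (map \<sigma> (\<tau> v))) \<subseteq> labels P" using \<sigma>w(2) by auto
    show "height R v = len (height P) (concat (map \<sigma> (\<tau> v)))"
      unfolding \<tau>v(3) using \<tau>v(2) len by (intro len_concat[symmetric]) auto
  next
    fix x assume x: "x \<in> topspace T"
    let ?v = "fst (address R x)"
    have v: "?v \<in> labels R" "snd (address R x) < height R ?v"
      using tower_partitionD(4,5)[OF assms(3) x] by auto
    have "set (\<tau> ?v) \<subseteq> labels Q" "snd (address R x) < len (height Q) (\<tau> ?v)"
      using \<tau> v unfolding refines_via_def by auto
    then have "lower (height P) (\<lambda>v. concat (map \<sigma> (\<tau> v))) (address R x) =
        lower (height P) \<sigma> (lower (height Q) \<tau> (address R x))"
      using len by (intro loc_concat) auto
    then show "address P x = lower (height P) (\<lambda>v. concat (map \<sigma> (\<tau> v))) (address R x)"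
      using \<sigma> \<tau> x unfolding refines_via_def by simp
  qed
  then show ?thesis unfolding refines_def by blast
qed

lemma refines_less:
  assumes "tower_scheme T S K P" "k < l"
  shows "refines (topspace T) (P k) (P l)"
  using \<open>k < l\<close>
proof (induction l)
  case (Suc l)
  have step: "refines (topspace T) (P l) (P (Suc l))" and part: "tower_partition T S (P (Suc l))"
    using assms(1) unfolding tower_scheme_def by blast+
  show ?case
  proof (cases "k = l")
    case False
    then show ?thesis using Suc by (intro refines_trans[OF _ step part]) auto
  qed (use step in simp)
qed simp

lemma refines_le_address:
  assumes "tower_scheme T S K P" "k \<le> l" "x \<in> topspace T" "y \<in> topspace T"
    "address (P l) x = address (P l) y"
  shows "address (P k) x = address (P k) y"
proof (cases "k = l")
  case False
  then have "k < l" using assms(2) by simp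
  then show ?thesis by (rule refines_address[OF refines_less[OF assms(1)] assms(3-5)])
qed (use assms in simp)

lemma tower_morphism_of_refines_via:
  assumes "refines_via (topspace T) P Q \<sigma>" "tower_partition T S P" "tower_partition T S Q"
  shows "tower_morphism (labels Q) (height Q) \<sigma> (height P)"
  using assms tower_partitionD(1,2)[OF assms(2)] tower_partitionD(1)[OF assms(3)]
  unfolding refines_via_def by unfold_locales auto

text \<open>The letters of the smaller alphabet become the towers of \<open>R\<close>: the letter \<open>y\<close> is the stack \<open>\<alpha> y\<close> of
  towers of \<open>P\<close>, and \<open>\<tau> v\<close> says how tower \<open>v\<close> of \<open>Q\<close> is stacked from them.\<close>

lemma intermediate_of_defect:
  assumes \<sigma>: "refines_via (topspace T) P Q \<sigma>" and P: "tower_partition T S P" and Q: "tower_partition T S Q"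
    and "defect \<sigma> (labels Q)"
  obtains R where "tower_partition T S R" "card (labels R) < card (labels Q)"
    "refines (topspace T) P R" "refines (topspace T) R Q"
proof -
  obtain \<tau> :: "nat \<Rightarrow> nat list" and \<alpha> where
    \<tau>: "\<And>v. v \<in> labels Q \<Longrightarrow> \<tau> v \<noteq> [] \<and> \<sigma> v = concat (map \<alpha> (\<tau> v))" and
    \<alpha>: "\<And>y. y \<in> (\<Union>v\<in>labels Q. set (\<tau> v)) \<Longrightarrow> \<alpha> y \<noteq> []" and
    card: "card (\<Union>v\<in>labels Q. set (\<tau> v)) < card (labels Q)"
    using \<open>defect \<sigma> (labels Q)\<close> unfolding defect_def by metis
  define Y where "Y = (\<Union>v\<in>labels Q. set (\<tau> v))"
  define hY where "hY y = len (height P) (\<alpha> y)" for y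
  define R where "R = \<lparr>labels = Y, height = hY, address = (\<lambda>x. lower hY \<tau> (address Q x))\<rparr>"
  have \<alpha>P: "set (\<alpha> y) \<subseteq> labels P" if "y \<in> Y" for y
  proof -
    obtain v where v: "v \<in> labels Q" "y \<in> set (\<tau> v)" using \<open>y \<in> Y\<close> unfolding Y_def by blast
    then have "set (\<alpha> y) \<subseteq> set (\<sigma> v)" using \<tau> by auto
    then show ?thesis using \<sigma> v unfolding refines_via_def by blast
  qed
  have hYpos: "0 < hY y" if "y \<in> Y" for y
    using \<alpha>[of y] \<alpha>P[OF that] that tower_partitionD(2)[OF P] unfolding hY_def Y_def
    by (cases "\<alpha> y") auto
  have len: "height Q v = len hY (\<tau> v)" if "v \<in> labels Q" for v
    using \<sigma> that \<tau>[OF that] len_concat[of "\<tau> v" hY "height P" \<alpha>] unfolding refines_via_def hY_def by simp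
  have in_tower: "snd (address Q x) < len hY (\<tau> (fst (address Q x)))" if "x \<in> topspace T" for x
    using tower_partitionD(4,5)[OF Q that] len by simp
  have "tower_partition T S R"
    unfolding tower_partition_def
  proof (intro conjI ballI)
    show "finite (labels R)" using tower_partitionD(1)[OF Q] unfolding R_def Y_def by simp
    show "0 < height R v" if "v \<in> labels R" for v using that hYpos unfolding R_def by simp
    have "continuous_map T (discrete_topology UNIV) ((\<lambda>a. lower hY \<tau> a) \<circ> address Q)"
      using tower_partitionD(3)[OF Q] by (rule continuous_map_compose) simp
    then show "continuous_map T (discrete_topology UNIV) (address R)" unfolding R_def by (simp add: o_def)
  next
    fix x assume x: "x \<in> topspace T"
    let ?v = "fst (address Q x)" and ?t = "snd (address Q x)"
    have v: "?v \<in> labels Q" by (rule tower_partitionD(4)[OF Q x])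
    note b = loc_bounds[OF in_tower[OF x]]
    show "fst (address R x) \<in> labels R" using b(1) v unfolding R_def Y_def by auto
    show "snd (address R x) < height R (fst (address R x))" using b(2) unfolding R_def by simp
    have vY: "set (\<tau> w) \<subseteq> Y" if "w \<in> labels Q" for w using that unfolding Y_def by blast
    show "if Suc (snd (address R x)) < height R (fst (address R x))
        then address R (S x) = (fst (address R x), Suc (snd (address R x)))
        else snd (address R (S x)) = 0"
    proof (cases "Suc ?t < height Q ?v")
      case True
      then have "address Q (S x) = (?v, Suc ?t)" using tower_partitionD(6)[OF Q x] by simp
      then show ?thesis using loc_Suc[OF in_tower[OF x]] True len[OF v] hYpos vY[OF v]
        unfolding R_def by auto
    next
      case False
      then have top: "\<not> Suc ?t < len hY (\<tau> ?v)" using len[OF v] by simp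
      have 0: "snd (address Q (S x)) = 0" using False tower_partitionD(6)[OF Q x] by simp
      have "snd (lower hY \<tau> (address Q (S x))) = 0" unfolding 0 by (rule snd_loc_0)
      then show ?thesis using loc_Suc(1)[OF in_tower[OF x]] top unfolding R_def by auto
    qed
  qed
  moreover have "card (labels R) < card (labels Q)" using card unfolding R_def Y_def by simp
  moreover have "refines_via (topspace T) P R \<alpha>"
    unfolding refines_via_def
  proof (intro conjI ballI)
    show "\<alpha> y \<noteq> []" "set (\<alpha> y) \<subseteq> labels P" "height R y = len (height P) (\<alpha> y)" if "y \<in> labels R" for y
      using that \<alpha> \<alpha>P unfolding R_def Y_def[symmetric] hY_def by auto
  next
    fix x assume x: "x \<in> topspace T"
    have "address P x = lower (height P) \<sigma> (address Q x)" using \<sigma> x unfolding refines_via_def by blast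
    also have "\<dots> = loc (height P) (concat (map \<alpha> (\<tau> (fst (address Q x))))) (snd (address Q x))"
      using \<tau>[OF tower_partitionD(4)[OF Q x]] by simp
    also have "\<dots> = lower (height P) \<alpha> (lower hY \<tau> (address Q x))"
      using in_tower[OF x] by (intro loc_concat) (simp_all add: hY_def)
    finally show "address P x = lower (height P) \<alpha> (address R x)" unfolding R_def by simp
  qed
  moreover have "refines_via (topspace T) R Q \<tau>"
    unfolding refines_via_def R_def using \<tau> len by (auto simp: Y_def)
  ultimately show ?thesis using that unfolding refines_def by blast
qed

text \<open>In such a scheme no morphism between two levels has a defect: the letters of a smaller alphabet would
  be the towers of a partition in between.\<close>

definition rigid_scheme :: "'a topology \<Rightarrow> ('a \<Rightarrow> 'a) \<Rightarrow> nat \<Rightarrow> (nat \<Rightarrow> 'a towers) \<Rightarrow> bool" where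
  "rigid_scheme T S K P \<longleftrightarrow> tower_scheme T S K P \<and>
     (\<forall>k l R. k < l \<longrightarrow> tower_partition T S R \<longrightarrow> refines (topspace T) (P k) R \<longrightarrow>
        refines (topspace T) R (P l) \<longrightarrow> K \<le> card (labels R))"

text \<open>In a scheme of least width, partitions with fewer than \<open>K\<close> towers cannot occur between levels \<open>k < l\<close>
  with \<open>k\<close> arbitrarily large: choosing infinitely many of them, separated by levels of the scheme, would
  yield a scheme of smaller width. So a tail of the scheme is rigid.\<close>

lemma rigid_scheme_exists:
  fixes P0 :: "nat \<Rightarrow> 'a towers"
  assumes "tower_scheme T S K0 P0"
  obtains K P where "rigid_scheme T S K P"
proof -
  define K where "K = (LEAST K. \<exists>P. tower_scheme T S K P)"
  obtain P where P: "tower_scheme T S K P"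
    using LeastI[of "\<lambda>K. \<exists>P. tower_scheme T S K P"] assms unfolding K_def by blast
  have least: "K \<le> K'" if "tower_scheme T S K' P'" for K' P'
    unfolding K_def using that by (intro Least_le) blast
  define narrow where "narrow k l R \<longleftrightarrow> k < l \<and> tower_partition T S R \<and> refines (topspace T) (P k) R \<and>
      refines (topspace T) R (P l) \<and> card (labels R) < K" for k l R
  have "\<exists>k0. \<forall>k\<ge>k0. \<forall>l R. \<not> narrow k l R"
  proof (rule ccontr)
    assume "\<not> ?thesis"
    then have ex: "\<exists>k\<ge>k0. \<exists>l R. narrow k l R" for k0 by blast
    have "\<exists>f :: nat \<Rightarrow> nat \<times> nat \<times> 'a towers. \<forall>n. (case f n of (k, l, R) \<Rightarrow> n \<le> k \<and> narrow k l R) \<and>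
        (case f n of (k, l, R) \<Rightarrow> case f (Suc n) of (k', l', R') \<Rightarrow> l < k')"
    proof (rule dependent_nat_choice)
      show "\<exists>x. case x of (k, l, R) \<Rightarrow> 0 \<le> k \<and> narrow k l R" using ex[of 0] by auto
    next
      fix x :: "nat \<times> nat \<times> 'a towers" and n
      obtain k l R where x: "x = (k, l, R)" by (cases x)
      obtain k' l' R' where "Suc (l + n) \<le> k'" "narrow k' l' R'" using ex[of "Suc (l + n)"] by blast
      then show "\<exists>y. (case y of (k, l, R) \<Rightarrow> Suc n \<le> k \<and> narrow k l R) \<and>
          (case x of (k, l, R) \<Rightarrow> case y of (k', l', R') \<Rightarrow> l < k')"
        unfolding x by (intro exI[of _ "(k', l', R')"]) auto
    qed
    then obtain f where f: "\<forall>n. (case f n of (k, l, R) \<Rightarrow> n \<le> k \<and> narrow k l R) \<and>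
        (case f n of (k, l, R) \<Rightarrow> case f (Suc n) of (k', l', R') \<Rightarrow> l < k')" ..
    define k l R where "k n = fst (f n)" and "l n = fst (snd (f n))" and "R n = snd (snd (f n))" for n
    have kl: "n \<le> k n" "narrow (k n) (l n) (R n)" "l n < k (Suc n)" for n
      using spec[OF f, of n] unfolding k_def l_def R_def by (auto split: prod.splits)
    have part: "tower_partition T S (P n)" for n using P unfolding tower_scheme_def by blast
    have "tower_scheme T S (K - 1) R"
      unfolding tower_scheme_def
    proof (intro conjI allI ballI impI)
      fix i
      show R: "tower_partition T S (R i)" using kl(2)[of i] unfolding narrow_def by blast
      show "card (labels (R i)) \<le> K - 1" using kl(2)[of i] unfolding narrow_def by linarith
      have 1: "refines (topspace T) (R i) (P (l i))" using kl(2)[of i] unfolding narrow_def by blast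
      have 2: "refines (topspace T) (P (l i)) (P (k (Suc i)))" by (rule refines_less[OF P kl(3)])
      have 3: "refines (topspace T) (P (k (Suc i))) (R (Suc i))" "tower_partition T S (R (Suc i))"
        using kl(2)[of "Suc i"] unfolding narrow_def by blast+
      show "refines (topspace T) (R i) (R (Suc i))"
        by (rule refines_trans[OF refines_trans[OF 1 2 part] 3])
    next
      fix x y assume xy: "x \<in> topspace T" "y \<in> topspace T" "\<forall>i. address (R i) x = address (R i) y"
      have "address (P i) x = address (P i) y" for i
      proof -
        have "refines (topspace T) (P (k i)) (R i)" using kl(2)[of i] unfolding narrow_def by blast
        then have "address (P (k i)) x = address (P (k i)) y" using refines_address[OF _ xy(1,2)] xy(3) by metis
        then show ?thesis by (rule refines_le_address[OF P kl(1) xy(1,2)])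
      qed
      then show "x = y" using P xy unfolding tower_scheme_def by blast
    qed
    moreover have "0 < K" using kl(2)[of 0] unfolding narrow_def by linarith
    ultimately show False using least[of "K - 1" R] by simp
  qed
  then obtain k0 where k0: "\<And>k l R. k0 \<le> k \<Longrightarrow> \<not> narrow k l R" by blast
  have "rigid_scheme T S K (\<lambda>i. P (i + k0))"
    unfolding rigid_scheme_def
  proof (intro conjI allI impI)
    show "tower_scheme T S K (\<lambda>i. P (i + k0))"
      unfolding tower_scheme_def
    proof (intro conjI allI ballI impI)
      fix x y assume xy: "x \<in> topspace T" "y \<in> topspace T" "\<forall>i. address (P (i + k0)) x = address (P (i + k0)) y"
      then have "address (P i) x = address (P i) y" for i
        using refines_le_address[OF P le_add1 xy(1,2)] by blast
      then show "x = y" using P xy unfolding tower_scheme_def by blast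
    qed (use P in \<open>auto simp: tower_scheme_def\<close>)
    fix k l R
    assume "k < l" "tower_partition T S R" "refines (topspace T) (P (k + k0)) R" "refines (topspace T) R (P (l + k0))"
    then show "K \<le> card (labels R)" using k0[of "k + k0" "l + k0" R] unfolding narrow_def by auto
  qed
  then show ?thesis by (rule that)
qed

section \<open>Names of orbits\<close>

lemma periodic_mult:
  fixes f :: "int \<Rightarrow> 'b"
  assumes "\<And>n. f (n + int p) = f n"
  shows "f (n + int p * z) = f n"
proof (induction z rule: int_induct[where k = 0])
  case (step1 i)
  then show ?case using assms[of "n + int p * i"] by (simp add: algebra_simps)
next
  case (step2 i)
  then show ?case using assms[of "n + int p * (i - 1)"] by (simp add: algebra_simps)
qed simp

lemma periodic_dvd:
  fixes f :: "int \<Rightarrow> 'b"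
  assumes "\<And>n. f (n + int p) = f n" "p dvd q"
  shows "f (n + int q) = f n"
  using periodic_mult[of f p n] assms by (metis dvdE of_nat_mult)

locale compact_system =
  fixes T :: "'a topology" and S :: "'a \<Rightarrow> 'a"
  assumes homeo: "homeomorphic_map T T S" and compact: "compact_space T"
begin

abbreviation X :: "'a set" where "X \<equiv> topspace T"
abbreviation it :: "int \<Rightarrow> 'a \<Rightarrow> 'a" where "it \<equiv> int_iterate X S"

lemma bij: "bij_betw S X X"
  unfolding bij_betw_def using homeomorphic_imp_injective_map[OF homeo] homeomorphic_imp_surjective_map[OF homeo] by simp

lemma it_in: "x \<in> X \<Longrightarrow> it m x \<in> X"
  by (rule int_iterate_step(1)[OF bij])

lemma it_add: "x \<in> X \<Longrightarrow> it m (it n x) = it (m + n) x"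
  by (rule int_iterate_add[OF bij, symmetric])

lemma it_0: "it 0 x = x"
  by (rule int_iterate_0)

lemma it_Suc: "x \<in> X \<Longrightarrow> it (m + 1) x = S (it m x)"
  by (rule int_iterate_step(2)[OF bij])

lemma it_1: "x \<in> X \<Longrightarrow> it 1 x = S x"
  using it_Suc[of x 0] it_0 by simp

lemma continuous_it: "continuous_map T T (it m)"
proof -
  define R where "R = inv_into X S"
  obtain g where g: "homeomorphic_maps T T S g" using homeo homeomorphic_map_maps by blast
  then have "\<And>x. x \<in> X \<Longrightarrow> S (g x) = x" "\<And>x. x \<in> X \<Longrightarrow> g x \<in> X"
    unfolding homeomorphic_maps_def continuous_map_def by blast+
  then have "g x = R x" if "x \<in> X" for x
    using that bij unfolding R_def by (metis bij_betw_imp_inj_on inv_into_f_eq)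
  moreover have "continuous_map T T g" using g unfolding homeomorphic_maps_def by blast
  ultimately have R: "continuous_map T T R" using continuous_map_eq by blast
  have pow: "continuous_map T T (F ^^ k)" if "continuous_map T T F" for F k
    using that by (induction k) (auto intro: continuous_map_compose)
  show ?thesis
    using pow[OF homeomorphic_imp_continuous_map[OF homeo]] pow[OF R]
    unfolding int_iterate_def R_def by (cases "0 \<le> m") auto
qed

definition name :: "'a towers \<Rightarrow> 'a \<Rightarrow> int \<Rightarrow> nat \<times> nat" where
  "name P x n = address P (it n x)"

lemma name_it: "x \<in> X \<Longrightarrow> name P (it m x) n = name P x (n + m)"
  unfolding name_def by (simp add: it_add)

lemma tower_name_name:
  assumes "tower_partition T S P" "x \<in> X"
  shows "tower_name (labels P) (height P) (name P x)"
  unfolding tower_name_def name_def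
  using tower_partitionD(4-6)[OF assms(1) it_in[OF assms(2)]] by (simp add: it_Suc[OF assms(2)])

lemma name_closed:
  assumes "tower_partition T S P"
  shows "closedin T {x \<in> X. name P x m = name P x n}"
    "closedin T {x \<in> X. name P x m = c}"
proof -
  have cont: "continuous_map T (discrete_topology UNIV) (\<lambda>x. name P x m)" for m
    unfolding name_def using continuous_map_compose[OF continuous_it tower_partitionD(3)[OF assms]]
    by (simp add: o_def)
  show "closedin T {x \<in> X. name P x m = name P x n}"
    by (rule closedin_continuous_maps_eq[OF _ cont cont]) simp
  show "closedin T {x \<in> X. name P x m = c}"
    by (rule closedin_continuous_maps_eq[OF _ cont, of "\<lambda>_. c"]) simp_all
qed

abbreviation name_periodic :: "'a towers \<Rightarrow> nat \<Rightarrow> 'a \<Rightarrow> bool" where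
  "name_periodic P q x \<equiv> \<forall>n. name P x (n + int q) = name P x n"

lemma refines_name:
  assumes "refines X P Q" "x \<in> X" "y \<in> X" "name Q x m = name Q y n"
  shows "name P x m = name P y n"
  using refines_address[OF assms(1) it_in[OF assms(2)] it_in[OF assms(3)]] assms(4) unfolding name_def .

text \<open>The two points have different names at some later level \<open>l\<close>, while rigidity rules out a defect of the
  morphism from level \<open>l\<close> to level \<open>k\<close>.\<close>

lemma periodic_of_indistinct:
  assumes rigid: "rigid_scheme T S K P" and xy: "x \<in> X" "y \<in> X" "x \<noteq> y"
    and eq: "\<And>n. name (P k) x n = name (P k) y n"
  shows "\<exists>q>0. name_periodic (P k) q x"
proof -
  have scheme: "tower_scheme T S K P" using rigid unfolding rigid_scheme_def by blast
  then obtain l where l: "address (P l) x \<noteq> address (P l) y" using xy unfolding tower_scheme_def by blast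
  have "k < l"
  proof (rule ccontr)
    assume "\<not> k < l"
    then show False
      using l refines_le_address[OF scheme, of l k x y] xy eq[of 0] unfolding name_def by (simp add: it_0)
  qed
  note ref = refines_less[OF scheme this]
  then obtain \<sigma> where \<sigma>: "refines_via X (P k) (P l) \<sigma>" unfolding refines_def by blast
  have part: "tower_partition T S (P i)" "card (labels (P i)) \<le> K" for i
    using scheme unfolding tower_scheme_def by blast+
  interpret tower_morphism "labels (P l)" "height (P l)" \<sigma> "height (P k)"
    by (rule tower_morphism_of_refines_via[OF \<sigma> part(1) part(1)])
  have low: "lower (height (P k)) \<sigma> (name (P l) z n) = name (P k) z n" if "z \<in> X" for z n
    using \<sigma> it_in[OF that] unfolding refines_via_def name_def by metis
  have "name (P l) x \<noteq> name (P l) y" using l fun_cong[of "name (P l) x" "name (P l) y" 0]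
    unfolding name_def by (auto simp: it_0)
  then have "defect \<sigma> (labels (P l)) \<or> (\<exists>q>0. name_periodic (P l) q x)"
    using defect_or_periodic[OF tower_name_name[OF part(1) xy(1)] tower_name_name[OF part(1) xy(2)]]
      low xy eq by metis
  then show ?thesis
  proof
    assume "defect \<sigma> (labels (P l))"
    then obtain R where "tower_partition T S R" "card (labels R) < card (labels (P l))"
      "refines X (P k) R" "refines X R (P l)"
      using intermediate_of_defect[OF \<sigma> part(1) part(1)] by metis
    then have False using rigid \<open>k < l\<close> part(2)[of l] unfolding rigid_scheme_def by (meson le_less_trans not_less order_trans)
    then show ?thesis ..
  next
    assume "\<exists>q>0. name_periodic (P l) q x"
    then show ?thesis using refines_name[OF ref xy(1) xy(1)] by blast
  qed
qed

lemma separating_level: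
  assumes scheme: "tower_scheme T S K P" and F: "finite F" "F \<subseteq> X"
  obtains l where "inj_on (address (P l)) F"
proof -
  have "\<exists>l. address (P l) x \<noteq> address (P l) y" if "x \<in> F" "y \<in> F" "x \<noteq> y" for x y
    using scheme that F unfolding tower_scheme_def by blast
  then obtain l where l: "\<And>x y. x \<in> F \<Longrightarrow> y \<in> F \<Longrightarrow> x \<noteq> y \<Longrightarrow> address (P (l x y)) x \<noteq> address (P (l x y)) y"
    by metis
  define L where "L = Max (insert 0 ((\<lambda>(x, y). l x y) ` (F \<times> F)))"
  have "inj_on (address (P L)) F"
  proof (rule inj_onI, rule ccontr)
    fix x y assume xy: "x \<in> F" "y \<in> F" "address (P L) x = address (P L) y" "x \<noteq> y"
    have "l x y \<le> L" unfolding L_def using xy F by (intro Max_ge) auto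
    then have "address (P (l x y)) x = address (P (l x y)) y"
      using refines_le_address[OF scheme] xy F by blast
    then show False using l xy by blast
  qed
  then show ?thesis by (rule that)
qed

lemma height_mono:
  assumes scheme: "tower_scheme T S K P" and "l \<le> l'" "x \<in> X"
  shows "height (P l) (fst (address (P l) x)) \<le> height (P l') (fst (address (P l') x))"
proof (cases "l = l'")
  case False
  then obtain \<sigma> where \<sigma>: "refines_via X (P l) (P l') \<sigma>"
    using refines_less[OF scheme, of l l'] assms(2) unfolding refines_def by auto
  let ?v = "fst (address (P l') x)"
  have part: "tower_partition T S (P l')" using scheme unfolding tower_scheme_def by blast
  have v: "height (P l') ?v = len (height (P l)) (\<sigma> ?v)"
    using \<sigma> tower_partitionD(4)[OF part assms(3)] unfolding refines_via_def by blast
  then have "fst (lower (height (P l)) \<sigma> (address (P l') x)) \<in> set (\<sigma> ?v)"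
    using tower_partitionD(5)[OF part assms(3)] by (intro loc_bounds) simp
  then have "fst (address (P l) x) \<in> set (\<sigma> ?v)" using \<sigma> assms(3) unfolding refines_via_def by simp
  then show ?thesis unfolding v by (intro member_le_sum_list) auto
qed simp

text \<open>The parts of the cylinders around \<open>y\<close> that lie outside of \<open>U\<close> are closed, decrease and have no point in
  common, so one of them is empty.\<close>

lemma cylinders_form_base:
  assumes scheme: "tower_scheme T S K P" and U: "openin T U" "y \<in> U"
  obtains k where "{w \<in> X. address (P k) w = address (P k) y} \<subseteq> U"
proof (rule ccontr)
  assume no: "\<not> thesis"
  have part: "tower_partition T S (P l)" "refines X (P l) (P (Suc l))" for l
    using scheme unfolding tower_scheme_def by blast+
  have y: "y \<in> X" using U openin_subset by blast
  define C where "C k = {w \<in> X. address (P k) w = address (P k) y} - U" for k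
  have "(\<Inter>k. C k) \<noteq> {}"
  proof (rule compact_space_imp_nest[OF compact])
    fix k
    have "closedin T {w \<in> X. address (P k) w = address (P k) y}"
      using name_closed(2)[OF part(1), of k 0 "address (P k) y"] unfolding name_def by (simp add: it_0)
    then show "closedin T (C k)" unfolding C_def using U(1) by (rule closedin_diff)
    show "C k \<noteq> {}" using no that[of k] unfolding C_def by blast
  next
    show "decseq C"
      unfolding C_def by (intro decseq_SucI) (use refines_address[OF part(2) _ y] in blast)
  qed
  then obtain w where w: "\<And>k. w \<in> C k" by blast
  then have "w = y" using scheme y unfolding tower_scheme_def C_def by blast
  then show False using w[of 0] U(2) unfolding C_def by blast
qed

end

section \<open>Points with periodic names\<close>

locale aperiodic_system = compact_system +
  assumes aperiodic: "aperiodic T S"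
begin

lemma it_inj:
  assumes x: "x \<in> X" and eq: "it m x = it n x"
  shows "m = n"
proof -
  have *: False if less: "m < n" and eq: "it m x = it n x" for m n
  proof -
    define d where "d = nat (n - m)"
    have d: "0 < d" "int d = n - m" using less unfolding d_def by auto
    have "it (k + int d) x = it k x" for k
    proof -
      have "k + int d = (k - m) + n" using d by simp
      then have "it (k + int d) x = it ((k - m) + n) x" by (rule arg_cong)
      then have "it (k + int d) x = it (k - m) (it n x)" unfolding it_add[OF x] .
      also have "\<dots> = it k x" unfolding eq[symmetric] using x by (simp add: it_add)
      finally show ?thesis .
    qed
    then have p: "it (k + int d * z) x = it k x" for k z
      using periodic_mult[of "\<lambda>k. it k x" d] by blast
    have "int_orbit X S x \<subseteq> (\<lambda>k. it k x) ` {0..<int d}"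
    proof -
      have "it k x = it (k mod int d) x" for k
        using p[of "k mod int d" "k div int d"] by simp
      moreover have "k mod int d \<in> {0..<int d}" for k using d by simp
      ultimately show ?thesis unfolding int_orbit_def by blast
    qed
    then have "finite (int_orbit X S x)" using finite_subset by blast
    then show False using aperiodic x unfolding aperiodic_def by blast
  qed
  show ?thesis using *[of m n] *[of n m] eq by (metis linorder_neqE)
qed

text \<open>A single tower may keep a bounded height through all levels, when two points of one orbit lie at the
  bottom of towers of every level. But if an orbit met only towers lower than \<open>M\<close>, each stretch of \<open>M\<close>
  of its points would contain one that is at the bottom of a tower of every level. Infinitely many points
  would be, whereas of such points at most \<open>K\<close> can be told apart at any level.\<close>

lemma tall_towers:
  assumes scheme: "tower_scheme T S K P" and x: "x \<in> X"
  obtains l where "\<And>l'. l \<le> l' \<Longrightarrow> \<exists>n. M \<le> height (P l') (fst (name (P l') x n))"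
proof (rule ccontr)
  assume "\<not> thesis"
  then have low': "\<exists>l'\<ge>l. \<forall>n. height (P l') (fst (name (P l') x n)) < M" for l
    using that by (metis not_less)
  have low: "height (P l) (fst (name (P l) x n)) < M" for l n
  proof -
    obtain l' where "l \<le> l'" "height (P l') (fst (name (P l') x n)) < M" using low' by blast
    then show ?thesis using height_mono[OF scheme, of l l' "it n x"] it_in[OF x] unfolding name_def by force
  qed
  have part: "tower_partition T S (P l)" "card (labels (P l)) \<le> K" for l
    using scheme unfolding tower_scheme_def by blast+
  define C where "C l = {j. snd (name (P l) x j) = 0}" for l
  have C_mono: "C l' \<subseteq> C l" if "l \<le> l'" for l l'
  proof (cases "l = l'")
    case False
    then have "l < l'" using that by simp
    then obtain \<sigma> where \<sigma>: "refines_via X (P l) (P l') \<sigma>"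
      using refines_less[OF scheme] unfolding refines_def by blast
    show ?thesis
    proof
      fix j assume "j \<in> C l'"
      then have 0: "snd (name (P l') x j) = 0" unfolding C_def by simp
      have "name (P l) x j = lower (height (P l)) \<sigma> (name (P l') x j)"
        using \<sigma> it_in[OF x] unfolding refines_via_def name_def by blast
      then have "snd (name (P l) x j) = 0" unfolding 0 by (simp add: snd_loc_0)
      then show "j \<in> C l" unfolding C_def by simp
    qed
  qed simp
  define J where "J = (\<Inter>l. C l)"
  \<comment> \<open>a decreasing sequence of nonempty finite sets has a common element\<close>
  have window: "\<exists>j\<in>J. n - int M \<le> j \<and> j \<le> n" for n
  proof (rule ccontr)
    assume "\<not> ?thesis"
    then have "\<forall>j\<in>{n - int M..n}. \<exists>l. j \<notin> C l" unfolding J_def by auto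
    then obtain l where l: "\<And>j. j \<in> {n - int M..n} \<Longrightarrow> j \<notin> C (l j)" by metis
    define L where "L = Max (l ` {n - int M..n})"
    have notL: "j \<notin> C L" if "j \<in> {n - int M..n}" for j
      using l[OF that] C_mono[of "l j" L] that unfolding L_def by (auto intro: Max_ge)
    let ?t = "snd (name (P L) x n)"
    have "n - int ?t \<in> C L"
      unfolding C_def using tower_name_base[OF tower_name_name[OF part(1) x]] by simp
    moreover have "?t < M"
      using low[of L n] tower_partitionD(5)[OF part(1) it_in[OF x]] unfolding name_def by (metis less_trans)
    ultimately show False using notL[of "n - int ?t"] by auto
  qed
  have "infinite J"
  proof
    assume "finite J"
    obtain j where j: "j \<in> J" "Min J - 1 - int M \<le> j" "j \<le> Min J - 1" using window by blast
    then have "Min J \<le> j" using \<open>finite J\<close> by (intro Min_le) auto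
    then show False using j by simp
  qed
  then obtain F where F: "F \<subseteq> J" "finite F" "card F = Suc K"
    using infinite_arbitrarily_large by blast
  have inj: "inj_on (\<lambda>j. it j x) F" by (rule inj_onI) (rule it_inj[OF x])
  obtain l where l: "inj_on (address (P l)) ((\<lambda>j. it j x) ` F)"
    using separating_level[OF scheme, of "(\<lambda>j. it j x) ` F"] F it_in[OF x] by blast
  have "inj_on (\<lambda>j. fst (name (P l) x j)) F"
  proof (rule inj_onI)
    fix i j assume ij: "i \<in> F" "j \<in> F" "fst (name (P l) x i) = fst (name (P l) x j)"
    then have "snd (name (P l) x i) = 0" "snd (name (P l) x j) = 0" using F(1) unfolding J_def C_def by auto
    then have "name (P l) x i = name (P l) x j" using ij by (simp add: prod_eq_iff)
    then have "it i x = it j x" using inj_onD[OF l] ij unfolding name_def by blast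
    then show "i = j" by (rule it_inj[OF x])
  qed
  moreover have "(\<lambda>j. fst (name (P l) x j)) ` F \<subseteq> labels (P l)"
    using tower_partitionD(4)[OF part(1) it_in[OF x]] unfolding name_def by blast
  ultimately have "card F \<le> card (labels (P l))"
    using tower_partitionD(1)[OF part(1)] by (rule card_inj_on_le)
  then show False using F(3) part(2)[of l] by simp
qed

text \<open>Suppose that \<open>K + 1\<close> points had periodic names of level \<open>k\<close> with different least periods, and let \<open>Q\<close> be
  the product of these. At a high level each of the points meets a tower of height at least \<open>Q\<close>, and two
  of these towers are equal. So the two names of level \<open>k\<close> agree on a stretch of length \<open>Q\<close>, which is a
  period of both; hence they agree everywhere up to a shift, and have the same least period. Since there
  are therefore at most \<open>K\<close> least periods, their product is a period for all points.\<close>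

lemma uniform_period:
  assumes scheme: "tower_scheme T S K P"
  obtains q where "0 < q" "\<And>x p. x \<in> X \<Longrightarrow> 0 < p \<Longrightarrow> name_periodic (P k) p x \<Longrightarrow> name_periodic (P k) q x"
proof -
  have part: "tower_partition T S (P l)" "card (labels (P l)) \<le> K" for l
    using scheme unfolding tower_scheme_def by blast+
  define per where "per x p \<longleftrightarrow> 0 < p \<and> name_periodic (P k) p x" for x p
  define lp where "lp x = (LEAST p. per x p)" for x
  define D where "D = lp ` {x \<in> X. \<exists>p. per x p}"
  have lp: "per x (lp x)" if "per x p" for x p using that unfolding lp_def by (rule LeastI)
  have finD: "finite D"
  proof (rule ccontr)
    assume "infinite D"
    then obtain E where E: "E \<subseteq> D" "finite E" "card E = Suc K" using infinite_arbitrarily_large by blast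
    then have "\<forall>e\<in>E. \<exists>x. x \<in> X \<and> per x e \<and> lp x = e" unfolding D_def using lp by blast
    then obtain g where g: "\<And>e. e \<in> E \<Longrightarrow> g e \<in> X \<and> per (g e) e \<and> lp (g e) = e" by metis
    define Q where "Q = \<Prod>E"
    have Qper: "name_periodic (P k) Q (g e)" if "e \<in> E" for e
    proof -
      have "e dvd Q" unfolding Q_def using that E(2) by (rule dvd_prodI[of E e "\<lambda>x. x", simplified, rotated])
      then show ?thesis using g[OF that] periodic_dvd[of "name (P k) (g e)" e Q] unfolding per_def by blast
    qed
    have "0 < Q" unfolding Q_def using g by (intro prod_pos) (auto simp: per_def)
    have "\<exists>l. \<forall>l'\<ge>l. \<exists>n. Q \<le> height (P l') (fst (name (P l') (g e) n))" if "e \<in> E" for e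
      using tall_towers[OF scheme, of "g e" Q] g[OF that] by metis
    then obtain l where l: "\<And>e l'. e \<in> E \<Longrightarrow> l e \<le> l' \<Longrightarrow> \<exists>n. Q \<le> height (P l') (fst (name (P l') (g e) n))"
      by metis
    define L where "L = Max (insert (Suc k) (l ` E))"
    have L: "l e \<le> L" if "e \<in> E" for e unfolding L_def using that E(2) by simp
    have kL: "k < L" using E(2) unfolding L_def by (metis Max_ge Suc_le_eq finite_imageI finite_insert insertI1)
    have "\<forall>e\<in>E. \<exists>n. Q \<le> height (P L) (fst (name (P L) (g e) n))" using l L by blast
    then obtain m where m: "\<And>e. e \<in> E \<Longrightarrow> Q \<le> height (P L) (fst (name (P L) (g e) (m e)))"
      by metis
    define v where "v e = fst (name (P L) (g e) (m e))" for e
    define c where "c e = m e - int (snd (name (P L) (g e) (m e)))" for e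
    have tn: "tower_name (labels (P L)) (height (P L)) (name (P L) (g e))" if "e \<in> E" for e
      using tower_name_name[OF part(1)] g[OF that] by blast
    have base: "name (P L) (g e) (c e) = (v e, 0)" if "e \<in> E" for e
      unfolding c_def v_def by (rule tower_name_base[OF tn[OF that]])
    have up: "name (P L) (g e) (c e + int t) = (v e, t)" if "e \<in> E" "t < Q" for e t
      using tower_name_within[OF tn[OF that(1)], of "c e" t] base[OF that(1)] m[OF that(1)] that(2)
      unfolding v_def[symmetric] by simp
    have "\<not> inj_on v E"
    proof
      assume "inj_on v E"
      moreover have "v ` E \<subseteq> labels (P L)" unfolding v_def using tower_nameD(1)[OF tn] by blast
      ultimately have "card E \<le> card (labels (P L))" using tower_partitionD(1)[OF part(1)] by (rule card_inj_on_le)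
      then show False using E(3) part(2)[of L] by simp
    qed
    then obtain e e' where e: "e \<in> E" "e' \<in> E" "v e = v e'" "e \<noteq> e'" unfolding inj_on_def by blast
    have same: "name (P k) (g e) (c e + n) = name (P k) (g e') (c e' + n)" for n
    proof -
      define t where "t = nat (n mod int Q)"
      have t: "t < Q" "n = int t + int Q * (n div int Q)"
        using \<open>0 < Q\<close> by (auto simp: t_def nat_less_iff)
      have red: "name (P k) (g d) (c d + n) = name (P k) (g d) (c d + int t)" if "d \<in> E" for d
        using periodic_mult[of "name (P k) (g d)" Q "c d + int t" "n div int Q"] Qper[OF that] t(2)
        by (metis add.assoc)
      have "name (P L) (g e) (c e + int t) = name (P L) (g e') (c e' + int t)"
        using up e t by simp
      then have "name (P k) (g e) (c e + int t) = name (P k) (g e') (c e' + int t)"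
        using refines_name[OF refines_less[OF scheme kL]] g e by blast
      then show ?thesis using red e by simp
    qed
    have "per (g e) p = per (g e') p" for p
    proof -
      have "name (P k) (g e) n = name (P k) (g e') (n + (c e' - c e))" for n
        using same[of "n - c e"] by (simp add: algebra_simps)
      then have "name_periodic (P k) p (g e) \<longleftrightarrow> (\<forall>n. name (P k) (g e') (n + (c e' - c e) + int p) = name (P k) (g e') (n + (c e' - c e)))"
        by (simp add: algebra_simps)
      also have "\<dots> \<longleftrightarrow> name_periodic (P k) p (g e')"
        by (metis diff_add_cancel)
      finally show ?thesis unfolding per_def by simp
    qed
    then have "per (g e) = per (g e')" by (rule ext)
    then have "lp (g e) = lp (g e')" unfolding lp_def by simp
    then show False using g e by metis
  qed
  show ?thesis
  proof (rule that[of "\<Prod>D"])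
    show "0 < \<Prod>D" unfolding D_def using lp by (intro prod_pos) (auto simp: per_def)
  next
    fix x p assume x: "x \<in> X" "0 < p" "name_periodic (P k) p x"
    then have "per x (lp x)" using lp[of x p] unfolding per_def by blast
    moreover have "lp x \<in> D" unfolding D_def using x(1) calculation by blast
    then have "lp x dvd \<Prod>D" using finD by (rule dvd_prodI[of D "lp x" "\<lambda>x. x", simplified, rotated])
    ultimately show "name_periodic (P k) (\<Prod>D) x" using periodic_dvd[of "name (P k) x" "lp x"] unfolding per_def by blast
  qed
qed

text \<open>With a common period \<open>q k\<close>, the points with a periodic name of level \<open>k\<close> form a closed set.\<close>

lemma all_names_periodic:
  assumes scheme: "tower_scheme T S K P" and ex: "\<And>k. \<exists>x\<in>X. \<exists>q>0. name_periodic (P k) q x"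
  obtains x where "x \<in> X" "\<And>k. \<exists>q>0. name_periodic (P k) q x"
proof -
  have "\<exists>q>0. \<forall>x p. x \<in> X \<longrightarrow> 0 < p \<longrightarrow> name_periodic (P k) p x \<longrightarrow> name_periodic (P k) q x" for k
    using uniform_period[OF scheme, of k] by metis
  then obtain q where q: "\<And>k. 0 < q k" "\<And>k x p. x \<in> X \<Longrightarrow> 0 < p \<Longrightarrow> name_periodic (P k) p x \<Longrightarrow> name_periodic (P k) (q k) x"
    by metis
  have part: "tower_partition T S (P l)" "refines X (P l) (P (Suc l))" for l
    using scheme unfolding tower_scheme_def by blast+
  define F where "F k = {x \<in> X. name_periodic (P k) (q k) x}" for k
  have "(\<Inter>k. F k) \<noteq> {}"
  proof (rule compact_space_imp_nest[OF compact])
    fix k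
    have "F k = (\<Inter>n. {x \<in> X. name (P k) x (n + int (q k)) = name (P k) x n})" unfolding F_def by auto
    also have "closedin T \<dots>" using name_closed(1)[OF part(1)] by (intro closedin_INT) auto
    finally show "closedin T (F k)" .
    show "F k \<noteq> {}" using ex[of k] q(2)[of _ _ k] unfolding F_def by blast
  next
    show "decseq F"
    proof (rule decseq_SucI, rule subsetI)
      fix k x assume "x \<in> F (Suc k)"
      then have x: "x \<in> X" "name_periodic (P (Suc k)) (q (Suc k)) x" unfolding F_def by auto
      then have "name_periodic (P k) (q (Suc k)) x" using refines_name[OF part(2)] by blast
      then show "x \<in> F k" unfolding F_def using x(1) q by blast
    qed
  qed
  then obtain x where "\<And>k. x \<in> F k" by blast
  then show ?thesis using that[of x] q(1) unfolding F_def by blast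
qed

section \<open>The odometer in the closure of an orbit with periodic names\<close>

text \<open>Let \<open>n k\<close> be the least period of the name of \<open>x\<close> at level \<open>k\<close>. A point in the orbit closure has at
  level \<open>k\<close> the name of \<open>x\<close>, shifted by a residue modulo \<open>n k\<close>; these residues are its coordinates in the
  odometer. The periods \<open>n k\<close> are unbounded because a common period at all levels would be a period
  of \<open>x\<close> itself.\<close>

lemma odometer_component:
  assumes scheme: "tower_scheme T S K P" and x: "x \<in> X"
    and periodic: "\<And>k. \<exists>q>0. name_periodic (P k) q x"
  obtains Z where "minimal_component T S Z" "conjugate_to_odometer (subtopology T Z) S"
proof -
  have part: "tower_partition T S (P l)" "refines X (P l) (P (Suc l))" for l
    using scheme unfolding tower_scheme_def by blast+
  have sep: "y = z" if "y \<in> X" "z \<in> X" "\<And>k. name (P k) y 0 = name (P k) z 0" for y z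
    using scheme that unfolding tower_scheme_def name_def by (simp add: it_0)
  define n where "n k = (LEAST q. 0 < q \<and> name_periodic (P k) q x)" for k
  have n: "0 < n k \<and> name_periodic (P k) (n k) x" for k
    unfolding n_def by (rule LeastI_ex[OF periodic])
  have npos: "0 < n k" for k using n by blast
  have nper: "name (P k) x (m + int (n k) * z) = name (P k) x m" for k m z
    using periodic_mult[of "name (P k) x" "n k" m z] n by blast
  have n_dvd: "int (n k) dvd d" if d: "\<And>m. name (P k) x (m + d) = name (P k) x m" for k d
  proof -
    define r where "r = d mod int (n k)"
    have r: "0 \<le> r" "r < int (n k)" "d = r + int (n k) * (d div int (n k))"
      using npos[of k] unfolding r_def by auto
    have "name (P k) x (m + r) = name (P k) x m" for m
      using nper[of k "m + r" "d div int (n k)"] d[of m] r(3) by (metis add.assoc)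
    then have "r = 0"
      using r(1,2) not_less_Least[of "nat r" "\<lambda>q. 0 < q \<and> name_periodic (P k) q x"]
      unfolding n_def[symmetric] by (simp add: nat_less_iff)
    then show ?thesis unfolding r_def by (simp add: dvd_eq_mod_eq_0)
  qed
  have n_Suc: "n k dvd n (Suc k)" for k
  proof -
    have "name (P k) x (m + int (n (Suc k))) = name (P k) x m" for m
      using refines_name[OF part(2) x x] n by blast
    then have "int (n k) dvd int (n (Suc k))" by (rule n_dvd)
    then show ?thesis by simp
  qed
  have n_mono: "n k \<le> n l" if "k \<le> l" for k l
    by (rule lift_Suc_mono_le[OF _ that]) (rule dvd_imp_le[OF n_Suc npos])
  have n_top: "filterlim n at_top sequentially"
  proof -
    have "\<exists>k. M \<le> n k" for M
    proof (rule ccontr)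
      assume "\<not> ?thesis"
      then have "n k dvd fact M" for k using npos[of k] by (intro dvd_fact) (auto simp: Suc_le_eq not_le less_imp_le)
      then have "name (P k) x (0 + int (fact M)) = name (P k) x 0" for k
        using periodic_dvd[of "name (P k) x" "n k" "fact M" 0] n[of k] by blast
      then have "it (int (fact M)) x = x"
        using sep[of "it (int (fact M)) x" x] it_in[OF x] x name_it[OF x] by simp
      then show False using it_inj[OF x, of "int (fact M)" 0] by (simp add: it_0)
    qed
    then show ?thesis
      unfolding filterlim_at_top eventually_sequentially using n_mono by (meson order_trans)
  qed
  \<comment> \<open>these sets depend on \<open>r\<close> modulo \<open>n k\<close> and become the cylinders of the odometer\<close>
  define A where "A k r = {y \<in> X. \<forall>m. name (P k) y m = name (P k) x (m + r)}" for k and r :: int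
  have A_closed: "closedin T (A k r)" for k r
  proof -
    have "A k r = (\<Inter>m. {y \<in> X. name (P k) y m = name (P k) x (m + r)})" unfolding A_def by auto
    also have "closedin T \<dots>" by (intro closedin_INT name_closed(2)[OF part(1)]) simp
    finally show ?thesis .
  qed
  have A_mod: "A k r = A k s" if dvd: "int (n k) dvd r - s" for k r s
  proof -
    obtain z where "r - s = int (n k) * z" using dvd by (rule dvdE)
    then have "r = s + int (n k) * z" by simp
    then have "name (P k) x (m + r) = name (P k) x (m + s)" for m
      using nper[of k "m + s" z] by (simp add: add.assoc)
    then show ?thesis unfolding A_def by simp
  qed
  have A_unique: "int (n k) dvd r - s" if "y \<in> A k r" "y \<in> A k s" for k r s y
  proof (rule n_dvd)
    fix m
    have "name (P k) x ((m - s) + r) = name (P k) x ((m - s) + s)" using that unfolding A_def by (metis (mono_tags, lifting) mem_Collect_eq)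
    then show "name (P k) x (m + (r - s)) = name (P k) x m" by (simp add: algebra_simps)
  qed
  have A_Suc: "A (Suc k) r \<subseteq> A k r" for k r
  proof
    fix y assume y: "y \<in> A (Suc k) r"
    then have "y \<in> X" unfolding A_def by blast
    then show "y \<in> A k r" using y refines_name[OF part(2) _ x] unfolding A_def by blast
  qed
  have A_it: "it m y \<in> A k (r + m)" if "y \<in> A k r" for m y k r
    using that it_in[of y m] name_it[of y] unfolding A_def by (auto simp: algebra_simps)
  have x_A: "x \<in> A k 0" for k using x unfolding A_def by simp
  \<comment> \<open>the closure of the orbit of \<open>x\<close>, in a form that shows it closed and invariant\<close>
  define Z where "Z = {y \<in> X. \<forall>k. \<exists>r. y \<in> A k r}"
  have ZX: "Z \<subseteq> X" unfolding Z_def by blast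
  have residue: "\<exists>r<n k. y \<in> A k (int r)" if y: "y \<in> Z" for y k
  proof -
    obtain r where r: "y \<in> A k r" using y unfolding Z_def by blast
    have "A k r = A k (int (nat (r mod int (n k))))"
      using npos[of k] by (intro A_mod) (simp add: mod_eq_dvd_iff[symmetric])
    moreover have "nat (r mod int (n k)) < n k" using npos[of k] by (simp add: nat_less_iff)
    ultimately show ?thesis using r by metis
  qed
  have it_Z: "it m y \<in> Z" if "y \<in> Z" for y m
    using that A_it it_in unfolding Z_def by blast
  have S_Z: "S y \<in> Z" if "y \<in> Z" for y
    using it_Z[OF that, of 1] it_1 that ZX by (metis subsetD)
  have Z_closed: "closedin T Z"
  proof -
    have "Z = (\<Inter>k. \<Union>r<n k. A k (int r))"
    proof
      show "Z \<subseteq> (\<Inter>k. \<Union>r<n k. A k (int r))" using residue by blast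
      have "A k r \<subseteq> X" for k r unfolding A_def by blast
      then show "(\<Inter>k. \<Union>r<n k. A k (int r)) \<subseteq> Z" unfolding Z_def by blast
    qed
    moreover have "closedin T (\<Union>r<n k. A k (int r))" for k using A_closed by (intro closedin_Union) auto
    ultimately show ?thesis by (auto intro!: closedin_INT)
  qed
  have dense: "T closure_of (int_orbit X S y) = Z" if y: "y \<in> Z" for y
  proof
    have "int_orbit X S y \<subseteq> Z" unfolding int_orbit_def using it_Z[OF y] by blast
    then show "T closure_of (int_orbit X S y) \<subseteq> Z" using Z_closed by (rule closure_of_minimal)
    show "Z \<subseteq> T closure_of (int_orbit X S y)"
    proof
      fix z assume z: "z \<in> Z"
      show "z \<in> T closure_of (int_orbit X S y)"
        unfolding in_closure_of
      proof (intro conjI allI impI)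
        show "z \<in> X" using z ZX by blast
        fix U assume "z \<in> U \<and> openin T U"
        then obtain k where k: "{w \<in> X. address (P k) w = address (P k) z} \<subseteq> U"
          using cylinders_form_base[OF scheme, of U z] by blast
        obtain r s where rs: "z \<in> A k r" "y \<in> A k s" using y z unfolding Z_def by blast
        have "it (r - s) y \<in> A k r" using A_it[OF rs(2), of "r - s"] by simp
        then have "name (P k) (it (r - s) y) 0 = name (P k) z 0" using rs(1) unfolding A_def by simp
        then have "it (r - s) y \<in> U" using k it_Z[OF y] ZX unfolding name_def by (auto simp: it_0)
        then show "\<exists>w. w \<in> int_orbit X S y \<and> w \<in> U" unfolding int_orbit_def by blast
      qed
    qed
  qed
  have "minimal_component T S Z"
    unfolding minimal_component_def
  proof (intro conjI ballI)
    show "Z \<noteq> {}" using x x_A unfolding Z_def by blast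
    show "S ` Z = Z"
    proof
      show "S ` Z \<subseteq> Z" using S_Z by blast
      show "Z \<subseteq> S ` Z"
      proof
        fix y assume y: "y \<in> Z"
        then have "y = S (it (- 1) y)" using it_Suc[of y "- 1"] it_0[of y] ZX by auto
        then show "y \<in> S ` Z" using it_Z[OF y] by blast
      qed
    qed
  qed (use Z_closed dense in auto)
  moreover have "conjugate_to_odometer (subtopology T Z) S"
  proof -
    define c where "c y k = (SOME r. r < n k \<and> y \<in> A k (int r))" for y k
    have c: "c y k < n k" "y \<in> A k (int (c y k))" if "y \<in> Z" for y k
      using someI_ex[OF residue[OF that, of k]] unfolding c_def by auto
    have c_eq: "c y k = r mod n k" if "y \<in> Z" "y \<in> A k (int r)" for y k r
    proof -
      have "int (n k) dvd int r - int (c y k)" using A_unique c(2)[OF that(1)] that(2) by blast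
      then have "r mod n k = c y k mod n k" by (metis mod_eq_dvd_iff of_nat_eq_iff zmod_int)
      then show ?thesis using c(1)[OF that(1), of k] by simp
    qed
    have topsp: "topspace (odometer_topology n) = {\<omega>. (\<forall>k. \<omega> k < n k) \<and> (\<forall>k. \<omega> (Suc k) mod n k = \<omega> k)}"
      unfolding odometer_topology_def by (auto simp: PiE_iff)
    have topZ: "topspace (subtopology T Z) = Z" using ZX by auto
    have c_odo: "c y (Suc k) mod n k = c y k" if "y \<in> Z" for y k
      using c_eq[OF that subsetD[OF A_Suc c(2)[OF that]]] by (rule sym)
    have cont_c: "continuous_map (subtopology T Z) (discrete_topology {..<n k}) (\<lambda>y. c y k)" for k
      unfolding continuous_map_closedin topZ
    proof (intro conjI allI impI)
      show "(\<lambda>y. c y k) \<in> Z \<rightarrow> topspace (discrete_topology {..<n k})" using c(1) by auto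
      fix C assume "closedin (discrete_topology {..<n k}) C"
      then have C: "C \<subseteq> {..<n k}" by simp
      then have "finite C" by (rule finite_subset) simp
      have "{y \<in> Z. c y k \<in> C} = Z \<inter> (\<Union>r\<in>C. A k (int r))"
        using c(2) c_eq C by fastforce
      moreover have "closedin T (\<Union>r\<in>C. A k (int r))" using A_closed \<open>finite C\<close> by (intro closedin_Union) auto
      ultimately show "closedin (subtopology T Z) {y \<in> Z. c y k \<in> C}"
        unfolding closedin_subtopology by blast
    qed
    have "homeomorphic_map (subtopology T Z) (odometer_topology n) c"
    proof (rule continuous_imp_homeomorphic_map)
      show "continuous_map (subtopology T Z) (odometer_topology n) c"
        unfolding odometer_topology_def continuous_map_in_subtopology
        using cont_c c_odo topZ by (auto simp: continuous_map_componentwise_UNIV)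
      show "compact_space (subtopology T Z)"
        using closedin_compact_space[OF compact Z_closed] by (simp add: compact_space_subtopology)
      show "Hausdorff_space (odometer_topology n)"
        unfolding odometer_topology_def
        by (intro Hausdorff_space_subtopology) (simp add: Hausdorff_space_product_topology)
      show "inj_on c (topspace (subtopology T Z))"
        unfolding topZ
      proof (rule inj_onI)
        fix y z assume yz: "y \<in> Z" "z \<in> Z" "c y = c z"
        have "name (P k) y 0 = name (P k) z 0" for k
          using c(2)[OF yz(1), of k] c(2)[OF yz(2), of k] yz(3) unfolding A_def by simp
        then show "y = z" using sep yz ZX by blast
      qed
      show "c ` topspace (subtopology T Z) = topspace (odometer_topology n)"
        unfolding topZ topsp
      proof (intro equalityI subsetI)
        fix \<omega> assume "\<omega> \<in> c ` Z"
        then show "\<omega> \<in> {\<omega>. (\<forall>k. \<omega> k < n k) \<and> (\<forall>k. \<omega> (Suc k) mod n k = \<omega> k)}" using c(1) c_odo by auto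
      next
        fix \<omega> assume "\<omega> \<in> {\<omega>. (\<forall>k. \<omega> k < n k) \<and> (\<forall>k. \<omega> (Suc k) mod n k = \<omega> k)}"
        then have \<omega>: "\<And>k. \<omega> k < n k" "\<And>k. \<omega> (Suc k) mod n k = \<omega> k" by auto
        have "(\<Inter>k. A k (int (\<omega> k))) \<noteq> {}"
        proof (rule compact_space_imp_nest[OF compact])
          show "closedin T (A k (int (\<omega> k)))" for k by (rule A_closed)
          show "A k (int (\<omega> k)) \<noteq> {}" for k using A_it[OF x_A[of k], of "int (\<omega> k)"] by auto
          have "A k (int (\<omega> (Suc k))) = A k (int (\<omega> k))" for k
          proof (rule A_mod)
            have "int (\<omega> (Suc k)) mod int (n k) = int (\<omega> k) mod int (n k)"
              using \<omega>(2)[of k] \<omega>(1)[of k] by (metis mod_mod_trivial zmod_int)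
            then show "int (n k) dvd int (\<omega> (Suc k)) - int (\<omega> k)" by (simp only: mod_eq_dvd_iff)
          qed
          then show "decseq (\<lambda>k. A k (int (\<omega> k)))" using A_Suc by (intro decseq_SucI) metis
        qed
        then obtain y where y: "\<And>k. y \<in> A k (int (\<omega> k))" by blast
        moreover have "y \<in> X" using y[of 0] unfolding A_def by blast
        ultimately have "y \<in> Z" unfolding Z_def by blast
        moreover have "c y = \<omega>" using c_eq[OF \<open>y \<in> Z\<close> y] \<omega>(1) by auto
        ultimately show "\<omega> \<in> c ` Z" by blast
      qed
    qed
    moreover have "c (S y) = odometer_map n (c y)" if y: "y \<in> Z" for y
    proof
      fix k
      have "S y = it 1 y" using it_1 y ZX by auto
      then have "S y \<in> A k (int (c y k + 1))" using A_it[OF c(2)[OF y], of 1 k] by (simp add: add.commute)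
      then show "c (S y) k = odometer_map n (c y) k" unfolding odometer_map_def by (rule c_eq[OF S_Z[OF y]])
    qed
    ultimately show ?thesis
      unfolding conjugate_to_odometer_def conjugate_systems_def topZ
      using npos n_Suc n_top by blast
  qed
  ultimately show ?thesis by (rule that)
qed

theorem some_level_separates_orbits:
  assumes scheme: "tower_scheme T S K P"
    and no_odometer: "\<And>Z. minimal_component T S Z \<Longrightarrow> \<not> conjugate_to_odometer (subtopology T Z) S"
  obtains Q where "tower_partition T S Q"
    "\<And>x y. x \<in> X \<Longrightarrow> y \<in> X \<Longrightarrow> x \<noteq> y \<Longrightarrow> \<exists>n. name Q x n \<noteq> name Q y n"
proof (rule ccontr)
  assume no: "\<not> thesis"
  obtain K' P' where rigid: "rigid_scheme T S K' P'" using rigid_scheme_exists[OF scheme] by blast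
  then have scheme': "tower_scheme T S K' P'" unfolding rigid_scheme_def by blast
  have "\<exists>x\<in>X. \<exists>q>0. name_periodic (P' k) q x" for k
  proof -
    have "tower_partition T S (P' k)" using scheme' unfolding tower_scheme_def by blast
    then have "\<exists>x\<in>X. \<exists>y\<in>X. x \<noteq> y \<and> (\<forall>n. name (P' k) x n = name (P' k) y n)"
      using no that[of "P' k"] by blast
    then show ?thesis using periodic_of_indistinct[OF rigid] by blast
  qed
  then obtain x where "x \<in> X" "\<And>k. \<exists>q>0. name_periodic (P' k) q x"
    using all_names_periodic[OF scheme'] by blast
  then obtain Z where "minimal_component T S Z" "conjugate_to_odometer (subtopology T Z) S"
    using odometer_component[OF scheme'] by blast
  then show False using no_odometer by blast
qed

end

section \<open>Bratteli diagrams as tower schemes\<close>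

lemma ex_sorted_enumeration:
  assumes "finite A" "\<And>x y. x \<in> A \<Longrightarrow> y \<in> A \<Longrightarrow> (x, y) \<in> R \<or> (y, x) \<in> R" "trans R"
  shows "\<exists>xs. distinct xs \<and> set xs = A \<and> sorted_wrt (\<lambda>x y. (x, y) \<in> R) xs"
  using assms(1,2)
proof (induction A)
  case (insert a A)
  then obtain xs where xs: "distinct xs" "set xs = A" "sorted_wrt (\<lambda>x y. (x, y) \<in> R) xs" by auto
  let ?l = "filter (\<lambda>x. (x, a) \<in> R) xs" and ?r = "filter (\<lambda>x. (x, a) \<notin> R) xs"
  have ay: "(a, y) \<in> R" if "y \<in> set ?r" for y using that insert.prems[of y a] xs(2) by auto
  have lr: "(x, y) \<in> R" if "x \<in> set ?l" "y \<in> set ?r" for x y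
    using ay[OF that(2)] that(1) transD[OF \<open>trans R\<close>, of x a y] by simp
  have la: "(x, a) \<in> R" if "x \<in> set ?l" for x using that by simp
  have "sorted_wrt (\<lambda>x y. (x, y) \<in> R) (?l @ a # ?r)"
    unfolding sorted_wrt_append sorted_wrt.simps list.set
    using sorted_wrt_filter[OF xs(3)] ay lr la by blast
  moreover have "distinct (?l @ a # ?r)" using xs insert.hyps by auto
  moreover have "set (?l @ a # ?r) = insert a A" using xs(2) by auto
  ultimately show ?case by blast
qed simp

lemma takeWhile_neq_nth:
  "distinct xs \<Longrightarrow> j < length xs \<Longrightarrow> takeWhile (\<lambda>f. f \<noteq> xs ! j) xs = take j xs"
proof (induction xs arbitrary: j)
  case (Cons x xs)
  then show ?case by (cases j) auto
qed simp

locale ordered_diagram =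
  fixes B :: "(nat, nat) bratteli"
  assumes diagram: "ordered_bratteli_diagram B"
begin

abbreviation "incoming i v \<equiv> {e \<in> edges B i. rng B e = v}"

definition enum :: "nat \<Rightarrow> nat \<Rightarrow> nat list" where
  "enum i v = (SOME xs. distinct xs \<and> set xs = incoming i v \<and> sorted_wrt (\<lambda>e f. (e, f) \<in> edge_order B i) xs)"

lemma diagramD:
  "finite (verts B i)" "finite (edges B i)" "src B ` edges B i = verts B i"
  "rng B ` edges B i = verts B (Suc i)" "partial_order_on (edges B i) (edge_order B i)"
  "e \<in> edges B i \<Longrightarrow> f \<in> edges B i \<Longrightarrow> rng B e = rng B f \<Longrightarrow>
     (e, f) \<in> edge_order B i \<or> (f, e) \<in> edge_order B i"
proof -
  have 1: "bratteli_diagram B" and 2: "partial_order_on (edges B i) (edge_order B i)"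
    and 3: "\<forall>e\<in>edges B i. \<forall>f\<in>edges B i.
      ((e, f) \<in> edge_order B i \<or> (f, e) \<in> edge_order B i) \<longleftrightarrow> rng B e = rng B f"
    using diagram unfolding ordered_bratteli_diagram_def by auto
  show "finite (verts B i)" "finite (edges B i)" "src B ` edges B i = verts B i"
    "rng B ` edges B i = verts B (Suc i)" using 1 unfolding bratteli_diagram_def by auto
  show "partial_order_on (edges B i) (edge_order B i)" by (rule 2)
  show "(e, f) \<in> edge_order B i \<or> (f, e) \<in> edge_order B i"
    if "e \<in> edges B i" "f \<in> edges B i" "rng B e = rng B f" using 3 that by simp
qed

lemma order_antisym: "(e, f) \<in> edge_order B i \<Longrightarrow> (f, e) \<in> edge_order B i \<Longrightarrow> e = f"
  using diagramD(5)[of i] unfolding partial_order_on_def antisym_def by blast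

lemma enum: "distinct (enum i v)" "set (enum i v) = incoming i v"
  "sorted_wrt (\<lambda>e f. (e, f) \<in> edge_order B i) (enum i v)"
proof -
  have "\<exists>xs. distinct xs \<and> set xs = incoming i v \<and> sorted_wrt (\<lambda>e f. (e, f) \<in> edge_order B i) xs"
  proof (rule ex_sorted_enumeration)
    show "finite (incoming i v)" using diagramD(2)[of i] by simp
    show "trans (edge_order B i)"
      using diagramD(5)[of i] unfolding partial_order_on_def preorder_on_def by blast
    show "(e, f) \<in> edge_order B i \<or> (f, e) \<in> edge_order B i"
      if "e \<in> incoming i v" "f \<in> incoming i v" for e f
      using that by (intro diagramD(6)) auto
  qed
  from someI_ex[OF this] show "distinct (enum i v)" "set (enum i v) = incoming i v"
    "sorted_wrt (\<lambda>e f. (e, f) \<in> edge_order B i) (enum i v)" unfolding enum_def by blast+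
qed

lemma enum_nth:
  assumes "e \<in> edges B i"
  obtains j where "j < length (enum i (rng B e))" "e = enum i (rng B e) ! j"
  using assms enum(2)[of i "rng B e"] by (metis (mono_tags, lifting) in_set_conv_nth mem_Collect_eq)

lemma enum_less: "j < k \<Longrightarrow> k < length (enum i v) \<Longrightarrow> (enum i v ! j, enum i v ! k) \<in> edge_order B i"
  using sorted_wrt_nth_less[OF enum(3)] .

lemma nth_enum: "j < length (enum i v) \<Longrightarrow> enum i v ! j \<in> edges B i \<and> rng B (enum i v ! j) = v"
  using enum(2)[of i v] nth_mem[of j "enum i v"] by auto

lemma enum_inj: "j < length (enum i v) \<Longrightarrow> k < length (enum i v) \<Longrightarrow> enum i v ! j = enum i v ! k \<Longrightarrow> j = k"
  using enum(1) nth_eq_iff_index_eq by blast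

lemma maximal_edge_index:
  assumes "maximal_edge B i (enum i v ! j)" "j < length (enum i v)"
  shows "Suc j = length (enum i v)"
proof (rule ccontr)
  assume "Suc j \<noteq> length (enum i v)"
  then have j: "Suc j < length (enum i v)" using assms(2) by simp
  then have "enum i v ! Suc j = enum i v ! j"
    using assms nth_enum[OF j] nth_enum[OF assms(2)] enum_less[of j "Suc j" i v] unfolding maximal_edge_def by auto
  then show False using enum_inj j assms(2) by fastforce
qed

lemma minimal_edge_index:
  assumes "minimal_edge B i (enum i v ! j)" "j < length (enum i v)"
  shows "j = 0"
proof (rule ccontr)
  assume "j \<noteq> 0"
  then have j: "0 < length (enum i v)" "0 < j" using assms(2) by auto
  then have "enum i v ! 0 = enum i v ! j"
    using assms nth_enum[OF j(1)] nth_enum[OF assms(2)] enum_less[of 0 j i v] unfolding minimal_edge_def by auto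
  then show False using enum_inj j assms(2) by fastforce
qed

lemma successor_edge_index:
  assumes succ: "successor_edge B i (enum i v ! j) f" and j: "j < length (enum i v)"
  shows "Suc j < length (enum i v) \<and> f = enum i v ! Suc j"
proof -
  have f: "f \<in> edges B i" "rng B f = v" "(enum i v ! j, f) \<in> edge_order B i" "f \<noteq> enum i v ! j"
    and least: "\<And>g. g \<in> edges B i \<Longrightarrow> rng B g = v \<Longrightarrow> (enum i v ! j, g) \<in> edge_order B i \<Longrightarrow>
      g \<noteq> enum i v ! j \<Longrightarrow> (f, g) \<in> edge_order B i"
    using succ nth_enum[OF j] unfolding successor_edge_def by auto
  obtain k where k: "k < length (enum i v)" "f = enum i v ! k" using enum_nth[OF f(1)] f(2) by metis
  have "\<not> k < j" using enum_less[of k j i v] j order_antisym f(3,4) k by blast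
  then have "j < k" using f(4) k by (metis linorder_neqE_nat)
  have "k = Suc j"
  proof (rule ccontr)
    assume "k \<noteq> Suc j"
    then have less: "Suc j < k" "Suc j < length (enum i v)" using \<open>j < k\<close> k by auto
    then have "(f, enum i v ! Suc j) \<in> edge_order B i"
      using nth_enum[OF less(2)] enum_less[of j "Suc j" i v] enum_inj[OF less(2) j] by (intro least) auto
    then have "f = enum i v ! Suc j" using enum_less[OF less(1) k(1)] order_antisym k(2) by blast
    then show False using enum_inj[OF k(1) less(2)] k(2) less by auto
  qed
  then show ?thesis using k by simp
qed

primrec tower_height :: "nat \<Rightarrow> nat \<Rightarrow> nat" where
  "tower_height 0 v = 1"
| "tower_height (Suc i) v = len (\<lambda>e. tower_height i (src B e)) (enum i v)"

text \<open>The number of paths from the top vertex to the range of \<open>e\<close> whose last edge is smaller than \<open>e\<close>.\<close>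

definition below :: "nat \<Rightarrow> nat \<Rightarrow> nat" where
  "below i e = len (\<lambda>e. tower_height i (src B e)) (takeWhile (\<lambda>f. f \<noteq> e) (enum i (rng B e)))"

text \<open>Among the paths from the top vertex to the source of \<open>x i\<close>, ordered by the last edge in which they
  differ, the first \<open>i\<close> edges of \<open>x\<close> form the one with \<open>rank i x\<close> predecessors.\<close>

primrec rank :: "nat \<Rightarrow> (nat \<Rightarrow> nat) \<Rightarrow> nat" where
  "rank 0 x = 0"
| "rank (Suc i) x = below i (x i) + rank i x"

text \<open>The tower of a vertex has one floor for each path that leads to it from the top vertex.\<close>

definition diagram_towers :: "nat \<Rightarrow> (nat \<Rightarrow> nat) towers" where
  "diagram_towers i = \<lparr>labels = verts B i, height = tower_height i, address = (\<lambda>x. (src B (x i), rank i x))\<rparr>"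

lemma pathsD:
  assumes "x \<in> paths B"
  shows "x i \<in> edges B i" "rng B (x i) = src B (x (Suc i))"
  using assms unfolding paths_def by auto

lemma below_nth:
  assumes "j < length (enum i v)"
  shows "below i (enum i v ! j) = len (\<lambda>e. tower_height i (src B e)) (take j (enum i v))"
  using takeWhile_neq_nth[OF enum(1) assms] nth_enum[OF assms] unfolding below_def by simp

lemma tower_height_Suc_nth:
  assumes "j < length (enum i v)"
  shows "tower_height (Suc i) v = below i (enum i v ! j) + tower_height i (src B (enum i v ! j)) +
    len (\<lambda>e. tower_height i (src B e)) (drop (Suc j) (enum i v))"
proof -
  have "enum i v = take j (enum i v) @ enum i v ! j # drop (Suc j) (enum i v)"
    using assms by (rule id_take_nth_drop)
  then have "tower_height (Suc i) v = len (\<lambda>e. tower_height i (src B e))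
      (take j (enum i v) @ enum i v ! j # drop (Suc j) (enum i v))" by simp
  then show ?thesis unfolding below_nth[OF assms] by simp
qed

lemma tower_height_pos: "v \<in> verts B i \<Longrightarrow> 0 < tower_height i v"
proof (induction i arbitrary: v)
  case (Suc i)
  then have "v \<in> rng B ` edges B i" using diagramD(4)[of i] by simp
  then obtain e where e: "e \<in> edges B i" "rng B e = v" by blast
  obtain j where j: "j < length (enum i v)" "e = enum i v ! j" using enum_nth[OF e(1)] e(2) by metis
  have "0 < tower_height i (src B e)" using Suc.IH e(1) diagramD(3)[of i] by blast
  then show ?case using tower_height_Suc_nth[OF j(1)] j(2) by simp
qed simp

lemma rank_less: "x \<in> paths B \<Longrightarrow> rank i x < tower_height i (src B (x i))"
proof (induction i)
  case (Suc i)
  obtain j where j: "j < length (enum i (rng B (x i)))" "x i = enum i (rng B (x i)) ! j"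
    using enum_nth[OF pathsD(1)[OF Suc.prems]] .
  have "rank (Suc i) x < tower_height (Suc i) (rng B (x i))"
    using tower_height_Suc_nth[OF j(1)] Suc unfolding j(2)[symmetric] by simp
  then show ?case using pathsD(2)[OF Suc.prems] by simp
qed simp

lemma rank_cong: "(\<And>j. j < i \<Longrightarrow> x j = y j) \<Longrightarrow> rank i x = rank i y"
  by (induction i) auto

lemma loc_rank:
  assumes x: "x \<in> paths B"
  shows "loc (tower_height i) (map (src B) (enum i (src B (x (Suc i))))) (rank (Suc i) x) = (src B (x i), rank i x)"
proof -
  define v where "v = rng B (x i)"
  obtain j where j: "j < length (enum i v)" "x i = enum i v ! j"
    using enum_nth[OF pathsD(1)[OF x, of i]] unfolding v_def .
  have split: "map (src B) (enum i v) = map (src B) (take j (enum i v)) @ src B (x i) # map (src B) (drop (Suc j) (enum i v))"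
    using id_take_nth_drop[OF j(1)] j(2) by (metis list.simps(9) map_append)
  have "len (tower_height i) (map (src B) (take j (enum i v))) = below i (x i)"
    unfolding j(2) below_nth[OF j(1)] by (simp add: o_def)
  then show ?thesis
    unfolding pathsD(2)[OF x, symmetric] v_def[symmetric] split using rank_less[OF x, of i] by (simp add: loc_append)
qed

text \<open>Every edge starts at a vertex that is the end of some path, so \<open>below\<close> is strictly increasing.\<close>

lemma edge_determined:
  assumes e: "e \<in> edges B i" and f: "f \<in> edges B i" and "rng B e = rng B f" "below i e = below i f"
  shows "e = f"
proof -
  define v where "v = rng B e"
  let ?h = "\<lambda>e. tower_height i (src B e)"
  obtain j where j: "j < length (enum i v)" "e = enum i v ! j" using enum_nth[OF e] unfolding v_def .
  obtain k where k: "k < length (enum i v)" "f = enum i v ! k" using enum_nth[OF f] assms(3) unfolding v_def by metis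
  have less: "below i (enum i v ! a) < below i (enum i v ! b)" if ab: "a < b" "b < length (enum i v)" for a b
  proof -
    have a: "a < length (enum i v)" using ab by simp
    have "0 < ?h (enum i v ! a)"
      using nth_enum[OF a] diagramD(3)[of i] by (intro tower_height_pos) blast
    moreover have "take b (enum i v) = take a (enum i v) @ enum i v ! a # drop (Suc a) (take b (enum i v))"
      using ab id_take_nth_drop[of a "take b (enum i v)"] by simp
    then have "len ?h (take b (enum i v)) = len ?h (take a (enum i v) @ enum i v ! a # drop (Suc a) (take b (enum i v)))"
      by simp
    ultimately show ?thesis unfolding below_nth[OF a] below_nth[OF ab(2)] by simp
  qed
  show ?thesis using less[of j k] less[of k j] j k assms(4) by (metis less_irrefl linorder_neqE_nat)
qed

lemma addresses_separate_paths:
  assumes x: "x \<in> paths B" and y: "y \<in> paths B"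
    and eq: "\<And>i. address (diagram_towers i) x = address (diagram_towers i) y"
  shows "x = y"
proof
  fix i
  have src: "src B (x j) = src B (y j)" and rank: "rank j x = rank j y" for j
    using eq[of j] unfolding diagram_towers_def by auto
  have "rng B (x i) = rng B (y i)" using src[of "Suc i"] pathsD(2)[OF x] pathsD(2)[OF y] by simp
  moreover have "below i (x i) = below i (y i)" using rank[of "Suc i"] rank[of i] by simp
  ultimately show "x i = y i" using edge_determined pathsD(1)[OF x] pathsD(1)[OF y] by blast
qed

lemma rank_of_maximal:
  assumes x: "x \<in> paths B" and "\<And>j. j < i \<Longrightarrow> maximal_edge B j (x j)"
  shows "Suc (rank i x) = tower_height i (src B (x i))"
  using assms(2)
proof (induction i)
  case (Suc i)
  define v where "v = rng B (x i)"
  obtain j where j: "j < length (enum i v)" "x i = enum i v ! j"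
    using enum_nth[OF pathsD(1)[OF x, of i]] unfolding v_def .
  have "Suc j = length (enum i v)" using Suc.prems[of i] j by (intro maximal_edge_index) auto
  then have "tower_height (Suc i) v = below i (x i) + tower_height i (src B (x i))"
    using tower_height_Suc_nth[OF j(1)] j(2) by simp
  also have "\<dots> = Suc (rank (Suc i) x)" using Suc by simp
  finally show ?case unfolding v_def pathsD(2)[OF x] by simp
qed simp

lemma rank_of_minimal:
  assumes x: "x \<in> paths B" and "\<And>j. j < i \<Longrightarrow> minimal_edge B j (x j)"
  shows "rank i x = 0"
  using assms(2)
proof (induction i)
  case (Suc i)
  define v where "v = rng B (x i)"
  obtain j where j: "j < length (enum i v)" "x i = enum i v ! j"
    using enum_nth[OF pathsD(1)[OF x, of i]] unfolding v_def .
  have "j = 0" using Suc.prems[of i] j by (intro minimal_edge_index) auto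
  then have "below i (x i) = 0" using below_nth[OF j(1)] j(2) by simp
  then show ?case using Suc by simp
qed simp

text \<open>This is addition of \<open>1\<close> with carry: the maximal edges before \<open>k\<close> are reset to rank \<open>0\<close>, and the
  paths that they exhaust are counted by the step from \<open>x k\<close> to its successor.\<close>

lemma rank_of_successor:
  assumes x: "x \<in> paths B" and y: "y \<in> paths B"
    and max: "\<And>j. j < k \<Longrightarrow> maximal_edge B j (x j)" and min: "\<And>j. j < k \<Longrightarrow> minimal_edge B j (y j)"
    and succ: "successor_edge B k (x k) (y k)" and eq: "\<And>j. k < j \<Longrightarrow> y j = x j" and "k < i"
  shows "rank i y = Suc (rank i x)"
  using \<open>k < i\<close>
proof (induction i)
  case (Suc i)
  show ?case
  proof (cases "k = i")
    case True
    define v where "v = rng B (x i)"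
    obtain j where j: "j < length (enum i v)" "x i = enum i v ! j"
      using enum_nth[OF pathsD(1)[OF x, of i]] unfolding v_def .
    have yi: "Suc j < length (enum i v)" "y i = enum i v ! Suc j"
      using successor_edge_index[of i v j "y i"] succ j True by auto
    have "below i (y i) = below i (x i) + tower_height i (src B (x i))"
      unfolding yi(2) j(2) below_nth[OF yi(1)] below_nth[OF j(1)] take_Suc_conv_app_nth[OF j(1)] by simp
    moreover have "rank i y = 0" using rank_of_minimal[OF y] min True by blast
    moreover have "Suc (rank i x) = tower_height i (src B (x i))" using rank_of_maximal[OF x] max True by blast
    ultimately show ?thesis by simp
  next
    case False
    then show ?thesis using Suc eq[of i] by simp
  qed
qed simp

lemma open_cylinder: "openin (path_topology B) {y \<in> paths B. \<forall>j<n. y j = x j}"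
  unfolding path_topology_def by (rule topology_generated_by_Basis) blast

text \<open>A Vershik map increases the rank at level \<open>i\<close> by one and keeps the vertex, unless the first \<open>i\<close> edges
  are maximal, in which case the orbit leaves the top of the tower and enters another one at the bottom.\<close>

lemma tower_scheme_of_diagram:
  assumes vershik: "vershik_map B \<phi>" and width: "\<And>i. card (verts B i) \<le> K"
  shows "tower_scheme (path_topology B) \<phi> K diagram_towers"
  unfolding tower_scheme_def topspace_path_topology
proof (intro conjI allI ballI impI)
  fix i
  show "card (labels (diagram_towers i)) \<le> K" using width by (simp add: diagram_towers_def)
  show "tower_partition (path_topology B) \<phi> (diagram_towers i)"
    unfolding tower_partition_def topspace_path_topology
  proof (intro conjI ballI)
    show "finite (labels (diagram_towers i))" using diagramD(1) by (simp add: diagram_towers_def)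
    show "0 < height (diagram_towers i) v" if "v \<in> labels (diagram_towers i)" for v
      using that tower_height_pos by (simp add: diagram_towers_def)
    show "continuous_map (path_topology B) (discrete_topology UNIV) (address (diagram_towers i))"
      unfolding continuous_map_def topspace_path_topology
    proof (intro conjI allI impI)
      fix U
      show "openin (path_topology B) {x \<in> paths B. address (diagram_towers i) x \<in> U}"
      proof (subst openin_subopen, intro ballI)
        fix x assume x: "x \<in> {x \<in> paths B. address (diagram_towers i) x \<in> U}"
        define C where "C = {y \<in> paths B. \<forall>j<Suc i. y j = x j}"
        have "C \<subseteq> {x \<in> paths B. address (diagram_towers i) x \<in> U}"
        proof
          fix y assume y: "y \<in> C"
          then have "address (diagram_towers i) y = address (diagram_towers i) x"
            using rank_cong[of i y x] unfolding C_def by (simp add: diagram_towers_def)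
          then show "y \<in> {x \<in> paths B. address (diagram_towers i) x \<in> U}"
            using x y unfolding C_def by (metis (no_types, lifting) mem_Collect_eq)
        qed
        moreover have "x \<in> C" using x unfolding C_def by simp
        moreover have "openin (path_topology B) C" unfolding C_def by (rule open_cylinder)
        ultimately show "\<exists>C. openin (path_topology B) C \<and> x \<in> C \<and> C \<subseteq> {x \<in> paths B. address (diagram_towers i) x \<in> U}"
          by blast
      qed
    qed simp
  next
    fix x assume x: "x \<in> paths B"
    show "fst (address (diagram_towers i) x) \<in> labels (diagram_towers i)"
      using pathsD(1)[OF x, of i] diagramD(3)[of i] by (auto simp: diagram_towers_def)
    show "snd (address (diagram_towers i) x) < height (diagram_towers i) (fst (address (diagram_towers i) x))"
      using rank_less[OF x] by (simp add: diagram_towers_def)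
    have \<phi>x: "\<phi> x \<in> paths B"
    proof -
      have "\<phi> ` paths B = paths B"
        using vershik homeomorphic_imp_surjective_map unfolding vershik_map_def topspace_path_topology[symmetric] by blast
      then show ?thesis using x by blast
    qed
    have "if Suc (rank i x) < tower_height i (src B (x i))
        then src B (\<phi> x i) = src B (x i) \<and> rank i (\<phi> x) = Suc (rank i x) else rank i (\<phi> x) = 0"
    proof (cases "x \<in> maximal_paths B")
      case True
      then have "\<phi> x \<in> minimal_paths B" using vershik unfolding vershik_map_def by blast
      then show ?thesis using True rank_of_maximal[OF x, of i] rank_of_minimal[OF \<phi>x, of i]
        unfolding maximal_paths_def minimal_paths_def by auto
    next
      case False
      define k where "k = (LEAST j. \<not> maximal_edge B j (x j))"
      have max: "maximal_edge B j (x j)" if "j < k" for j using that not_less_Least unfolding k_def by blast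
      have succ: "successor_edge B k (x k) (\<phi> x k)" and min: "\<And>j. j < k \<Longrightarrow> minimal_edge B j (\<phi> x j)"
        and eq: "\<And>j. k < j \<Longrightarrow> \<phi> x j = x j"
      proof -
        have "vershik_successor B x (\<phi> x)" using vershik False x unfolding vershik_map_def by blast
        then show "successor_edge B k (x k) (\<phi> x k)" "\<And>j. j < k \<Longrightarrow> minimal_edge B j (\<phi> x j)"
          "\<And>j. k < j \<Longrightarrow> \<phi> x j = x j"
          unfolding vershik_successor_def k_def[symmetric] Let_def by auto
      qed
      show ?thesis
      proof (cases "k < i")
        case True
        then have "rank i (\<phi> x) = Suc (rank i x)" "\<phi> x i = x i"
          using rank_of_successor[OF x \<phi>x max min succ eq] eq by auto
        then show ?thesis using rank_less[OF \<phi>x, of i] by auto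
      next
        case False
        then have "Suc (rank i x) = tower_height i (src B (x i))" "rank i (\<phi> x) = 0"
          using rank_of_maximal[OF x, of i] rank_of_minimal[OF \<phi>x, of i] max min by auto
        then show ?thesis by simp
      qed
    qed
    then show "if Suc (snd (address (diagram_towers i) x)) < height (diagram_towers i) (fst (address (diagram_towers i) x))
        then address (diagram_towers i) (\<phi> x) = (fst (address (diagram_towers i) x), Suc (snd (address (diagram_towers i) x)))
        else snd (address (diagram_towers i) (\<phi> x)) = 0"
      by (simp add: diagram_towers_def)
  qed
  have "refines_via (paths B) (diagram_towers i) (diagram_towers (Suc i)) (\<lambda>v. map (src B) (enum i v))"
    unfolding refines_via_def
  proof (intro conjI ballI)
    fix v assume "v \<in> labels (diagram_towers (Suc i))"
    then have "v \<in> rng B ` edges B i" using diagramD(4)[of i] by (simp add: diagram_towers_def)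
    then show "map (src B) (enum i v) \<noteq> []" using enum(2)[of i v] by auto
    show "set (map (src B) (enum i v)) \<subseteq> labels (diagram_towers i)"
      using enum(2)[of i v] diagramD(3)[of i] by (auto simp: diagram_towers_def)
    show "height (diagram_towers (Suc i)) v = len (height (diagram_towers i)) (map (src B) (enum i v))"
      by (simp add: diagram_towers_def o_def)
  next
    fix x assume "x \<in> paths B"
    then show "address (diagram_towers i) x =
        lower (height (diagram_towers i)) (\<lambda>v. map (src B) (enum i v)) (address (diagram_towers (Suc i)) x)"
      using loc_rank[of x i] by (simp add: diagram_towers_def)
  qed
  then show "refines (paths B) (diagram_towers i) (diagram_towers (Suc i))" unfolding refines_def by blast
next
  fix x y assume "x \<in> paths B" "y \<in> paths B" "\<forall>i. address (diagram_towers i) x = address (diagram_towers i) y"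
  then show "x = y" using addresses_separate_paths by blast
qed

end

lemma tower_scheme_of_conjugate:
  assumes scheme: "tower_scheme T' S' K P" and conj: "conjugate_systems T S T' S'"
  shows "\<exists>P'. tower_scheme T S K P'"
proof -
  obtain h where h: "homeomorphic_map T T' h" and hS: "\<And>x. x \<in> topspace T \<Longrightarrow> h (S x) = S' (h x)"
    using conj unfolding conjugate_systems_def by blast
  have hx: "h x \<in> topspace T'" if "x \<in> topspace T" for x
    using that homeomorphic_imp_surjective_map[OF h] by blast
  define P' where "P' i = \<lparr>labels = labels (P i), height = height (P i), address = (\<lambda>x. address (P i) (h x))\<rparr>" for i
  have "tower_scheme T S K P'"
    unfolding tower_scheme_def
  proof (intro conjI allI ballI impI)
    fix i
    have part: "tower_partition T' S' (P i)" and card: "card (labels (P i)) \<le> K"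
      and "refines (topspace T') (P i) (P (Suc i))"
      using scheme unfolding tower_scheme_def by blast+
    then obtain \<sigma> where \<sigma>: "refines_via (topspace T') (P i) (P (Suc i)) \<sigma>" unfolding refines_def by blast
    have "continuous_map T (discrete_topology UNIV) (address (P i) \<circ> h)"
      using homeomorphic_imp_continuous_map[OF h] tower_partitionD(3)[OF part] by (rule continuous_map_compose)
    then show "tower_partition T S (P' i)"
      using tower_partitionD(1,2,4-6)[OF part] hx
      unfolding tower_partition_def P'_def by (simp add: o_def hS)
    show "card (labels (P' i)) \<le> K" using card unfolding P'_def by simp
    have "refines_via (topspace T) (P' i) (P' (Suc i)) \<sigma>"
      using \<sigma> hx unfolding refines_via_def P'_def by simp
    then show "refines (topspace T) (P' i) (P' (Suc i))" unfolding refines_def by blast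
  next
    fix x y assume xy: "x \<in> topspace T" "y \<in> topspace T" "\<forall>i. address (P' i) x = address (P' i) y"
    then have "h x = h y" using scheme hx unfolding tower_scheme_def P'_def by auto
    then show "x = y" using homeomorphic_imp_injective_map[OF h] xy by (auto dest: inj_onD)
  qed
  then show ?thesis by blast
qed

section \<open>Expansiveness\<close>

text \<open>\<open>\<delta>\<close> is a Lebesgue number of the covering by the fibres of \<open>f\<close>.\<close>

lemma locally_constant_imp_uniformly:
  assumes compact: "compact_space (mtopology_of m)"
    and f: "continuous_map (mtopology_of m) (discrete_topology UNIV) f"
  obtains \<delta> where "0 < \<delta>"
    "\<And>x y. x \<in> mspace m \<Longrightarrow> y \<in> mspace m \<Longrightarrow> mdist m x y < \<delta> \<Longrightarrow> f x = f y"
proof -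
  interpret Metric_space "mspace m" "mdist m" by simp
  define \<C> where "\<C> = range (\<lambda>c. {x \<in> mspace m. f x = c})"
  have "\<exists>\<epsilon>>0. \<forall>x\<in>mspace m. \<exists>U\<in>\<C>. mball x \<epsilon> \<subseteq> U"
  proof (rule lebesgue_number)
    show "compactin mtopology (mspace m)"
      using compact unfolding compact_space_def mtopology_of_def by simp
    show "openin mtopology U" if U: "U \<in> \<C>" for U
    proof -
      obtain c where c: "U = {x \<in> mspace m. f x = c}" using U unfolding \<C>_def by blast
      have "openin (mtopology_of m) {x \<in> topspace (mtopology_of m). f x \<in> {c}}"
        using f by (rule openin_continuous_map_preimage) simp
      then show ?thesis unfolding c by (simp add: mtopology_of_def)
    qed
  qed (auto simp: \<C>_def)
  then obtain \<epsilon> where \<epsilon>: "\<epsilon> > 0" "\<forall>x\<in>mspace m. \<exists>U\<in>\<C>. mball x \<epsilon> \<subseteq> U" by blast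
  show ?thesis
  proof (rule that[OF \<epsilon>(1)])
    fix x y assume xy: "x \<in> mspace m" "y \<in> mspace m" "mdist m x y < \<epsilon>"
    then obtain U where U: "U \<in> \<C>" "mball x \<epsilon> \<subseteq> U" using \<epsilon> by blast
    have "x \<in> mball x \<epsilon>" "y \<in> mball x \<epsilon>" using xy \<epsilon>(1) by auto
    then show "f x = f y" using U unfolding \<C>_def by blast
  qed
qed

theorem theorem4p8:
  fixes X :: "'a metric" and S :: "'a \<Rightarrow> 'a" and K :: nat
  assumes "cantor_set X"
    and "homeomorphic_map (mtopology_of X) (mtopology_of X) S"
    and "aperiodic (mtopology_of X) S"
    and "has_topological_rank (mtopology_of X) S K"
    and "\<And>Z. minimal_component (mtopology_of X) S Z \<Longrightarrow>
           \<not> conjugate_to_odometer (subtopology (mtopology_of X) Z) S"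
  shows "expansive X S"
proof -
  have compact: "compact_space (mtopology_of X)" using assms(1) unfolding cantor_set_def by blast
  interpret aperiodic_system "mtopology_of X" S
    using assms(2,3) compact by unfold_locales
  have "realizable_with_width (mtopology_of X) S K"
    using assms(4) unfolding has_topological_rank_def by blast
  then obtain B \<phi> where real: "bratteli_vershik_realization (mtopology_of X) S B \<phi>"
    and width: "\<And>i. card (verts B i) \<le> K"
    unfolding realizable_with_width_def by blast
  then have B: "ordered_bratteli_diagram B" and vershik: "vershik_map B \<phi>"
    and conj: "conjugate_systems (mtopology_of X) S (path_topology B) \<phi>"
    unfolding bratteli_vershik_realization_def by blast+
  interpret ordered_diagram B using B by unfold_locales
  have "tower_scheme (path_topology B) \<phi> K diagram_towers"
    using vershik width by (rule tower_scheme_of_diagram)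
  then obtain P where P: "tower_scheme (mtopology_of X) S K P"
    using tower_scheme_of_conjugate[OF _ conj] by blast
  obtain Q where Q: "tower_partition (mtopology_of X) S Q"
    and separates: "\<And>x y. x \<in> mspace X \<Longrightarrow> y \<in> mspace X \<Longrightarrow> x \<noteq> y \<Longrightarrow> \<exists>n. name Q x n \<noteq> name Q y n"
    using some_level_separates_orbits[OF P assms(5)] unfolding topspace_mtopology_of by blast
  obtain \<delta> where \<delta>: "0 < \<delta>" "\<And>x y. x \<in> mspace X \<Longrightarrow> y \<in> mspace X \<Longrightarrow> mdist X x y < \<delta> \<Longrightarrow>
      address Q x = address Q y"
    using locally_constant_imp_uniformly[OF compact tower_partitionD(3)[OF Q]] by blast
  show ?thesis
    unfolding expansive_def
  proof (intro exI[of _ "\<delta> / 2"] conjI ballI impI)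
    show "0 < \<delta> / 2" using \<delta>(1) by simp
    fix x y assume xy: "x \<in> mspace X" "y \<in> mspace X" "x \<noteq> y"
    then obtain n where n: "name Q x n \<noteq> name Q y n" using separates by blast
    have "it n x \<in> mspace X" "it n y \<in> mspace X" using it_in xy by auto
    then have "\<not> mdist X (it n x) (it n y) < \<delta>" using \<delta>(2) n unfolding name_def by blast
    then show "\<exists>m. \<delta> / 2 < mdist X (int_iterate (mspace X) S m x) (int_iterate (mspace X) S m y)"
      using \<delta>(1) by (intro exI[of _ n]) simp
  qed
qed

end
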